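(* Consider the uncertain nonlinear system $$x_{k+1}=Ax_k+Bu_k+B_dd_k+B_ww_k+B_w'w_k',\quad e_k=C_ex_k+D_{eu}u_k+D_{ed}d_k,$$ $$z_k=C_zx_k+D_zu_k+D_{zw}'w_k',\quad z_k'=C_z'x_k+D_z'u_k,\quad w_k=\Delta z_k,\quad w_k'=\Delta'(x_k)z_k',$$ with the data, sets, multiplier classes and performance index specified in the context; in particular, the multiplier assumptions (A1) on $\boldsymbol{\Delta}_{\rm prior}$, (A2) on $\boldsymbol{D}$ and (A3) on $\Delta'$ hold. Suppose there exist a symmetric $\mathcal{Y}\in\mathbb{R}^{n\times n}$ with $\mathcal{Y}\succ0$, $K\in\mathbb{R}^{m\times n}$, $\tilde{P}_{\rm com}\in\tilde{\boldsymbol{P}}_{\rm com}$ and $P'\in\boldsymbol{P'}$ such that $$F^\top\,\mathrm{diag}\big(-\mathcal{Y},\ \mathcal{Y},\ P',\ \tilde P_{\rm com},\ \tilde P_p\big)\,F\prec0,$$ where $$F=\begin{bmatrix} I & 0 & 0 & 0 \\ (A+BK)^\top & (C_z'+D_z'K)^\top & (C_z+D_zK)^\top & (C_e+D_{eu}K)^\top \\ 0 & I & 0 & 0 \\ {B_w'}^\top & 0 & {D_{zw}'}^\top & 0 \\ 0 & 0 & I & 0 \\ I & 0 & 0 & 0 \\ 0 & 0 & 0 & I \\ B_d^\top & 0 & 0 & D_{ed}^\top \end{bmatrix}$$ has block columns of widths $n,n_z',n_z,n_e$ and block rows of heights $n,n,n_z',n_w',n_z,n,n_e,n_d$ (so $P'$,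 $\tilde P_{\rm com}$ and $\tilde P_p$ act on block rows 3–4, 5–6 and 7–8, respectively). Then the system with $u_k=Kx_k$ is stable (for all $\Delta\in\boldsymbol{\Delta}_{\rm com}$ and all $\Delta'$ satisfying (A3)) and satisfies robust quadratic performance with index $P_p$.
   Context: All matrices are real; $\succ,\succeq,\prec,\preceq$ refer to (semi)definiteness of symmetric matrices. Dimensions: $x_k\in\mathbb{R}^n$, $u_k\in\mathbb{R}^m$, $d_k\in\mathbb{R}^{n_d}$, $e_k\in\mathbb{R}^{n_e}$, $w_k\in\mathbb{R}^{n_w}$, $z_k\in\mathbb{R}^{n_z}$, $w_k'\in\mathbb{R}^{n_w'}$, $z_k'\in\mathbb{R}^{n_z'}$. All matrices $A,B,B_d,B_w,B_w',C_e,D_{eu},D_{ed},C_z,D_z,D_{zw}',C_z',D_z'$ are given (known), and $B_d$ has full column rank. A convex cone of symmetric matrices "admits an LMI representation" if it is the projection of the solution set of a strictly feasible linear matrix inequality. (A1) Prior knowledge. Uncertainties $\Delta$ are block diagonal, $\Delta=\mathrm{diag}_{j=1}^{\ell}(\Delta_j)=\sum_{j=1}^{\ell}R_j\Delta_jL_j^\top$ with $\Delta_j\in\mathbb{R}^{n_{w,j}\times n_{z,j}}$, $\sum_j n_{w,j}=n_w$, $\sum_j n_{z,j}=n_z$, where $L_j$ and $R_j$ are the corresponding block columns of $I_{n_z}$ and $I_{n_w}$. Put $B_j=B_wR_j$, so $B_w=[B_1\ \cdots\ B_\ell]$; each $B_j$ has full column rank. The prior set is $\boldsymbol{\Delta}_{\rm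 prior}=\{\mathrm{diag}_{j=1}^\ell(\Delta_j)\mid\Delta_j\in\boldsymbol{\Delta}_j\}$ with $$\boldsymbol{\Delta}_j=\Big\{\Delta_j\in\mathbb{R}^{n_{w,j}\times n_{z,j}}\ \Big|\ \begin{bmatrix} \Delta_j^\top \\ I \end{bmatrix}^\top P_j\begin{bmatrix} \Delta_j^\top \\ I \end{bmatrix}\succeq0\ \ \forall P_j\in\boldsymbol{P}_j\Big\},$$ where $\boldsymbol{P}_j$ is a convex cone of symmetric matrices of size $n_{z,j}+n_{w,j}$ admitting an LMI representation, and for each $j$ some $P_j\in\boldsymbol{P}_j$ has negative definite left-upper $n_{z,j}\times n_{z,j}$ block. (A2) Disturbance in the data. $$\boldsymbol{D}=\Big\{D\in\mathbb{R}^{n_d\times N}\ \Big|\ \begin{bmatrix} D^\top \\ I \end{bmatrix}^\top P_d\begin{bmatrix} D^\top \\ I \end{bmatrix}\succeq0\ \ \forall P_d\in\boldsymbol{P}_d\Big\},$$ where $\boldsymbol{P}_d$ is a convex cone of symmetric matrices of size $N+n_d$ admitting an LMI representation, and some $P_d\in\boldsymbol{P}_d$ has negative definite left-upper $N\times N$ block. (A3) Nonlinear uncertainty. $\Delta':\mathbb{R}^n\to\mathbb{R}^{n_w'\times n_z'}$ is a (nonlinear) map with $\Delta'(0)=0$, and $\boldsymbol{P'}$ is a convex cone of symmetric matrices of size $n_z'+n_w'$ admitting an LMI representation such that for every $P'\in\boldsymbol{P'}$ $$\begin{bmatrix} \Delta'(x)^\top \\ I \end{bmatrix}^\top P'\begin{bmatrix}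 \Delta'(x)^\top \\ I \end{bmatrix}\succeq0\quad\text{for all }x\in\mathbb{R}^n.$$ Data. Data $\{x_k\}_{k=0}^N$, $\{u_k,\Delta'(x_k)\}_{k=0}^{N-1}$ of the system are given, generated with some (unknown) $\Delta=\Delta_{\rm tr}\in\boldsymbol{\Delta}_{\rm prior}$ and some (unknown) disturbance matrix $D_{\rm tr}=[\hat d_0\ \cdots\ \hat d_{N-1}]\in\boldsymbol{D}$. Set $X=[x_0\ \cdots\ x_{N-1}]$, $X_+=[x_1\ \cdots\ x_N]$, $U=[u_0\ \cdots\ u_{N-1}]$, $W'=[w_0'\ \cdots\ w_{N-1}']$ with $w_k'=\Delta'(x_k)(C_z'x_k+D_z'u_k)$, and $$M=X_+-AX-BU-B_w'W',\qquad Z=C_zX+D_zU+D_{zw}'W'.$$ Sets. $\boldsymbol{\Delta}_{\rm learnt}=\{\Delta\in\mathbb{R}^{n_w\times n_z}\mid M=B_w\Delta Z+B_dD\text{ for some }D\in\boldsymbol{D}\}$, $\boldsymbol{\Delta}_{\rm com}=\boldsymbol{\Delta}_{\rm prior}\cap\boldsymbol{\Delta}_{\rm learnt}$. Multipliers. $$\tilde{\boldsymbol{P}}=\sum_{j=1}^{\ell}\begin{bmatrix} L_j^\top & 0 \\ 0 & B_j^\top \end{bmatrix}^\top\boldsymbol{P}_j\begin{bmatrix} L_j^\top & 0 \\ 0 & B_j^\top \end{bmatrix},\qquad \tilde{\boldsymbol{P}}_0=\begin{bmatrix} -Z^\top & M^\top \\ 0 & B_d^\top \end{bmatrix}^\top\boldsymbol{P}_d\begin{bmatrix}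 -Z^\top & M^\top \\ 0 & B_d^\top \end{bmatrix},$$ $\tilde{\boldsymbol{P}}_{\rm com}=\tilde{\boldsymbol{P}}+\tilde{\boldsymbol{P}}_0$ (images and sums of sets are taken elementwise / in the Minkowski sense). Performance index. $P_p=\begin{bmatrix} Q_p & S_p \\ S_p^\top & R_p \end{bmatrix}$ is a symmetric invertible matrix with $Q_p$ of size $n_d\times n_d$ and $R_p$ of size $n_e\times n_e$; write $P_p^{-1}=\begin{bmatrix} \tilde Q_p & \tilde S_p \\ \tilde S_p^\top & \tilde R_p \end{bmatrix}$ (same partition) and $\tilde P_p=\begin{bmatrix} -\tilde R_p & \tilde S_p^\top \\ \tilde S_p & -\tilde Q_p \end{bmatrix}$. It is assumed that $\tilde Q_p\preceq0$. Definition (robust quadratic performance with index $P_p$). The system under state-feedback $u_k=Kx_k$ satisfies robust quadratic performance with index $P_p$ if there exists an $\varepsilon>0$ such that $$\sum_{k=0}^\infty\begin{bmatrix} d_k \\ e_k \end{bmatrix}^\top P_p\begin{bmatrix} d_k \\ e_k \end{bmatrix}\le-\varepsilon\sum_{k=0}^\infty d_k^\top d_k$$ for all square-summable sequences $d\in\ell_2$ and all uncertainties $\Delta\in\boldsymbol{\Delta}_{\rm com}$ and $\Delta'$ satisfying (A3) (with the given cone $\boldsymbol{P'}$). *)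

theory Defs
  imports Complex_Main "Jordan_Normal_Form.DL_Rank"
begin

text \<open>All dimensions are natural numbers (zero is not excluded), and matrices are real matrices
  with explicit carriers.\<close>

section \<open>Matrices, definiteness, convex cones of symmetric matrices\<close>

definition sym_mat :: "nat \<Rightarrow> real mat \<Rightarrow> bool" where
  "sym_mat n A \<longleftrightarrow> A \<in> carrier_mat n n \<and> A\<^sup>T = A"

definition pos_def :: "nat \<Rightarrow> real mat \<Rightarrow> bool" where
  "pos_def n A \<longleftrightarrow> sym_mat n A \<and> (\<forall>v \<in> carrier_vec n. v \<noteq> 0\<^sub>v n \<longrightarrow> v \<bullet> (A *\<^sub>v v) > 0)"

definition pos_semidef :: "nat \<Rightarrow> real mat \<Rightarrow> bool" where
  "pos_semidef n A \<longleftrightarrow> sym_mat n A \<and> (\<forall>v \<in> carrier_vec n. v \<bullet> (A *\<^sub>v v) \<ge> 0)"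

definition neg_def :: "nat \<Rightarrow> real mat \<Rightarrow> bool" where
  "neg_def n A \<longleftrightarrow> pos_def n (- A)"

definition neg_semidef :: "nat \<Rightarrow> real mat \<Rightarrow> bool" where
  "neg_semidef n A \<longleftrightarrow> pos_semidef n (- A)"

definition full_col_rank :: "real mat \<Rightarrow> bool" where
  "full_col_rank A \<longleftrightarrow> vec_space.rank (dim_row A) A = dim_col A"

definition append_cols :: "real mat \<Rightarrow> real mat \<Rightarrow> real mat" (infixr \<open>@\<^sub>c\<close> 70) where
  "A @\<^sub>c B = four_block_mat A B (0\<^sub>m 0 (dim_col A)) (0\<^sub>m 0 (dim_col B))"

definition upper_left :: "nat \<Rightarrow> real mat \<Rightarrow> real mat" where
  "upper_left q P = mat q q (\<lambda>ij. P $$ ij)"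

text \<open>Finite sums and affine combinations of matrices are written entrywise, since the type of
  matrices is not an additive monoid.\<close>

definition mat_sum :: "nat \<Rightarrow> nat \<Rightarrow> (nat \<Rightarrow> real mat) \<Rightarrow> nat set \<Rightarrow> real mat" where
  "mat_sum p q T I = mat p q (\<lambda>ij. \<Sum>k\<in>I. T k $$ ij)"

definition affine_mat :: "nat \<Rightarrow> nat \<Rightarrow> real mat \<Rightarrow> (nat \<Rightarrow> real mat) \<Rightarrow> real vec \<Rightarrow> real mat" where
  "affine_mat s r F0 F y = F0 + mat_sum s s (\<lambda>i. (y $ i) \<cdot>\<^sub>m F i) {..<r}"

text \<open>The scalars are positive, so a cone may, but need not, contain the zero matrix.\<close>

definition sym_convex_cone :: "nat \<Rightarrow> real mat set \<Rightarrow> bool" where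
  "sym_convex_cone s C \<longleftrightarrow> (\<forall>P\<in>C. sym_mat s P)
     \<and> (\<forall>P\<in>C. \<forall>Q\<in>C. P + Q \<in> C) \<and> (\<forall>P\<in>C. \<forall>c>0. c \<cdot>\<^sub>m P \<in> C)"

text \<open>The LMI is \<open>affine_mat q r F0 F y \<succeq> 0\<close> in the unknown \<open>y\<close>, strictly feasible if some \<open>y\<close>
  makes the left-hand side positive definite. ``Projection'' is understood as the image of
  the solution set under an affine map into the symmetric matrices. Coordinate projections are a
  special case. They alone would not do: the projection of a strictly feasible LMI with the
  entries of the matrix among its unknowns has nonempty interior in the symmetric matrices, which
  rules out, for example, the ray spanned by a single matrix.\<close>

definition admits_LMI :: "nat \<Rightarrow> real mat set \<Rightarrow> bool" where
  "admits_LMI s C \<longleftrightarrow> (\<exists>q r F0 F P0 P.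
     sym_mat q F0 \<and> (\<forall>i<r. sym_mat q (F i)) \<and> sym_mat s P0 \<and> (\<forall>i<r. sym_mat s (P i))
     \<and> (\<exists>y \<in> carrier_vec r. pos_def q (affine_mat q r F0 F y))
     \<and> C = {affine_mat s r P0 P y | y. y \<in> carrier_vec r \<and> pos_semidef q (affine_mat q r F0 F y)})"

section \<open>Uncertainty descriptions\<close>

definition qmi_set :: "nat \<Rightarrow> nat \<Rightarrow> real mat set \<Rightarrow> real mat set" where
  "qmi_set p q PP = {\<Delta> \<in> carrier_mat p q.
     \<forall>P\<in>PP. pos_semidef p ((\<Delta>\<^sup>T @\<^sub>r 1\<^sub>m p)\<^sup>T * P * (\<Delta>\<^sup>T @\<^sub>r 1\<^sub>m p))}"

definition multiplier_class :: "nat \<Rightarrow> nat \<Rightarrow> real mat set \<Rightarrow> bool" where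
  "multiplier_class p q PP \<longleftrightarrow> sym_convex_cone (q + p) PP \<and> admits_LMI (q + p) PP"

text \<open>The \<open>j\<close>-th block column of the identity matrix of size \<open>\<Sum>i<l. d i\<close>.\<close>

definition id_block_col :: "nat \<Rightarrow> (nat \<Rightarrow> nat) \<Rightarrow> nat \<Rightarrow> real mat" where
  "id_block_col l d j = mat (\<Sum>i<l. d i) (d j) (\<lambda>(r, c). 1\<^sub>m (\<Sum>i<l. d i) $$ (r, (\<Sum>i<j. d i) + c))"

definition Delta_prior ::
  "nat \<Rightarrow> (nat \<Rightarrow> nat) \<Rightarrow> (nat \<Rightarrow> nat) \<Rightarrow> (nat \<Rightarrow> real mat set) \<Rightarrow> real mat set" where
  "Delta_prior l nwj nzj PP =
     {diag_block_mat (map \<Delta> [0..<l]) | \<Delta>. \<forall>j<l. \<Delta> j \<in> qmi_set (nwj j) (nzj j) (PP j)}"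

definition nonlin_class ::
  "nat \<Rightarrow> nat \<Rightarrow> nat \<Rightarrow> real mat set \<Rightarrow> (real vec \<Rightarrow> real mat) set" where
  "nonlin_class n nw' nz' PP' = {\<Delta>'. (\<forall>x \<in> carrier_vec n. \<Delta>' x \<in> qmi_set nw' nz' PP')
     \<and> \<Delta>' (0\<^sub>v n) = 0\<^sub>m nw' nz'}"

section \<open>The system\<close>

record plant =
  pA :: "real mat"
  pB :: "real mat"
  pBd :: "real mat"
  pBw :: "real mat"
  pBw' :: "real mat"
  pCe :: "real mat"
  pDeu :: "real mat"
  pDed :: "real mat"
  pCz :: "real mat"
  pDz :: "real mat"
  pDzw' :: "real mat"
  pCz' :: "real mat"
  pDz' :: "real mat"

definition plant_dims ::
  "plant \<Rightarrow> nat \<Rightarrow> nat \<Rightarrow> nat \<Rightarrow> nat \<Rightarrow> nat \<Rightarrow> nat \<Rightarrow> nat \<Rightarrow> nat \<Rightarrow> bool" where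
  "plant_dims G n m nd ne nw nz nw' nz' \<longleftrightarrow>
     pA G \<in> carrier_mat n n \<and> pB G \<in> carrier_mat n m \<and> pBd G \<in> carrier_mat n nd \<and>
     pBw G \<in> carrier_mat n nw \<and> pBw' G \<in> carrier_mat n nw' \<and>
     pCe G \<in> carrier_mat ne n \<and> pDeu G \<in> carrier_mat ne m \<and> pDed G \<in> carrier_mat ne nd \<and>
     pCz G \<in> carrier_mat nz n \<and> pDz G \<in> carrier_mat nz m \<and> pDzw' G \<in> carrier_mat nz nw' \<and>
     pCz' G \<in> carrier_mat nz' n \<and> pDz' G \<in> carrier_mat nz' m"

definition out_z' :: "plant \<Rightarrow> real vec \<Rightarrow> real vec \<Rightarrow> real vec" where
  "out_z' G x u = pCz' G *\<^sub>v x + pDz' G *\<^sub>v u"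

definition in_w' :: "plant \<Rightarrow> (real vec \<Rightarrow> real mat) \<Rightarrow> real vec \<Rightarrow> real vec \<Rightarrow> real vec" where
  "in_w' G \<Delta>' x u = \<Delta>' x *\<^sub>v out_z' G x u"

definition out_z :: "plant \<Rightarrow> (real vec \<Rightarrow> real mat) \<Rightarrow> real vec \<Rightarrow> real vec \<Rightarrow> real vec" where
  "out_z G \<Delta>' x u = pCz G *\<^sub>v x + pDz G *\<^sub>v u + pDzw' G *\<^sub>v in_w' G \<Delta>' x u"

definition in_w ::
  "plant \<Rightarrow> real mat \<Rightarrow> (real vec \<Rightarrow> real mat) \<Rightarrow> real vec \<Rightarrow> real vec \<Rightarrow> real vec" where
  "in_w G \<Delta> \<Delta>' x u = \<Delta> *\<^sub>v out_z G \<Delta>' x u"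

definition next_state ::
  "plant \<Rightarrow> real mat \<Rightarrow> (real vec \<Rightarrow> real mat) \<Rightarrow> real vec \<Rightarrow> real vec \<Rightarrow> real vec \<Rightarrow> real vec" where
  "next_state G \<Delta> \<Delta>' x u d = pA G *\<^sub>v x + pB G *\<^sub>v u + pBd G *\<^sub>v d
     + pBw G *\<^sub>v in_w G \<Delta> \<Delta>' x u + pBw' G *\<^sub>v in_w' G \<Delta>' x u"

definition out_e :: "plant \<Rightarrow> real vec \<Rightarrow> real vec \<Rightarrow> real vec \<Rightarrow> real vec" where
  "out_e G x u d = pCe G *\<^sub>v x + pDeu G *\<^sub>v u + pDed G *\<^sub>v d"

primrec cl_state ::
  "plant \<Rightarrow> real mat \<Rightarrow> real mat \<Rightarrow> (real vec \<Rightarrow> real mat) \<Rightarrow> real vec \<Rightarrow> (nat \<Rightarrow> real vec)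
     \<Rightarrow> nat \<Rightarrow> real vec" where
  "cl_state G K \<Delta> \<Delta>' x0 d 0 = x0"
| "cl_state G K \<Delta> \<Delta>' x0 d (Suc k) =
     next_state G \<Delta> \<Delta>' (cl_state G K \<Delta> \<Delta>' x0 d k) (K *\<^sub>v cl_state G K \<Delta> \<Delta>' x0 d k) (d k)"

definition cl_out ::
  "plant \<Rightarrow> real mat \<Rightarrow> real mat \<Rightarrow> (real vec \<Rightarrow> real mat) \<Rightarrow> real vec \<Rightarrow> (nat \<Rightarrow> real vec)
     \<Rightarrow> nat \<Rightarrow> real vec" where
  "cl_out G K \<Delta> \<Delta>' x0 d k =
     out_e G (cl_state G K \<Delta> \<Delta>' x0 d k) (K *\<^sub>v cl_state G K \<Delta> \<Delta>' x0 d k) (d k)"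

section \<open>Data, sets compatible with the data, and multipliers\<close>

definition data_X :: "nat \<Rightarrow> nat \<Rightarrow> (nat \<Rightarrow> real vec) \<Rightarrow> real mat" where
  "data_X n N x = mat_of_cols n (map x [0..<N])"

definition data_M ::
  "plant \<Rightarrow> nat \<Rightarrow> nat \<Rightarrow> nat \<Rightarrow> nat \<Rightarrow> (real vec \<Rightarrow> real mat) \<Rightarrow> (nat \<Rightarrow> real vec)
     \<Rightarrow> (nat \<Rightarrow> real vec) \<Rightarrow> real mat" where
  "data_M G n m nw' N \<Delta>' x u = data_X n N (\<lambda>k. x (Suc k)) - pA G * data_X n N x
     - pB G * data_X m N u - pBw' G * data_X nw' N (\<lambda>k. in_w' G \<Delta>' (x k) (u k))"

definition data_Z ::
  "plant \<Rightarrow> nat \<Rightarrow> nat \<Rightarrow> nat \<Rightarrow> nat \<Rightarrow> (real vec \<Rightarrow> real mat) \<Rightarrow> (nat \<Rightarrow> real vec)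
     \<Rightarrow> (nat \<Rightarrow> real vec) \<Rightarrow> real mat" where
  "data_Z G n m nw' N \<Delta>' x u = pCz G * data_X n N x + pDz G * data_X m N u
     + pDzw' G * data_X nw' N (\<lambda>k. in_w' G \<Delta>' (x k) (u k))"

definition Delta_learnt ::
  "plant \<Rightarrow> nat \<Rightarrow> nat \<Rightarrow> real mat set \<Rightarrow> real mat \<Rightarrow> real mat \<Rightarrow> real mat set" where
  "Delta_learnt G nw nz DD M Z =
     {\<Delta> \<in> carrier_mat nw nz. \<exists>D\<in>DD. M = pBw G * \<Delta> * Z + pBd G * D}"

definition mult_prior ::
  "plant \<Rightarrow> nat \<Rightarrow> nat \<Rightarrow> (nat \<Rightarrow> nat) \<Rightarrow> (nat \<Rightarrow> nat) \<Rightarrow> (nat \<Rightarrow> real mat set) \<Rightarrow> real mat set" where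
  "mult_prior G n l nwj nzj PP =
     (let nz = (\<Sum>j<l. nzj j);
          T = (\<lambda>j. four_block_mat ((id_block_col l nzj j)\<^sup>T) (0\<^sub>m (nzj j) n)
                     (0\<^sub>m (nwj j) nz) ((pBw G * id_block_col l nwj j)\<^sup>T))
      in {mat_sum (nz + n) (nz + n) (\<lambda>j. (T j)\<^sup>T * P j * T j) {..<l} | P. \<forall>j<l. P j \<in> PP j})"

definition mult_learnt ::
  "plant \<Rightarrow> nat \<Rightarrow> nat \<Rightarrow> real mat set \<Rightarrow> real mat \<Rightarrow> real mat \<Rightarrow> real mat set" where
  "mult_learnt G nd nz PPd M Z =
     (let T = four_block_mat (- (Z\<^sup>T)) (M\<^sup>T) (0\<^sub>m nd nz) ((pBd G)\<^sup>T) in {T\<^sup>T * P * T | P. P \<in> PPd})"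

definition mult_com ::
  "real mat set \<Rightarrow> real mat set \<Rightarrow> real mat set" where
  "mult_com PP PP0 = {P + P0 | P P0. P \<in> PP \<and> P0 \<in> PP0}"

definition outer_factor ::
  "plant \<Rightarrow> real mat \<Rightarrow> nat \<Rightarrow> nat \<Rightarrow> nat \<Rightarrow> nat \<Rightarrow> nat \<Rightarrow> nat \<Rightarrow> real mat" where
  "outer_factor G K n nd ne nz nw' nz' =
     (1\<^sub>m n @\<^sub>c 0\<^sub>m n nz' @\<^sub>c 0\<^sub>m n nz @\<^sub>c 0\<^sub>m n ne) @\<^sub>r
     ((pA G + pB G * K)\<^sup>T @\<^sub>c (pCz' G + pDz' G * K)\<^sup>T @\<^sub>c (pCz G + pDz G * K)\<^sup>T
        @\<^sub>c (pCe G + pDeu G * K)\<^sup>T) @\<^sub>r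
     (0\<^sub>m nz' n @\<^sub>c 1\<^sub>m nz' @\<^sub>c 0\<^sub>m nz' nz @\<^sub>c 0\<^sub>m nz' ne) @\<^sub>r
     ((pBw' G)\<^sup>T @\<^sub>c 0\<^sub>m nw' nz' @\<^sub>c (pDzw' G)\<^sup>T @\<^sub>c 0\<^sub>m nw' ne) @\<^sub>r
     (0\<^sub>m nz n @\<^sub>c 0\<^sub>m nz nz' @\<^sub>c 1\<^sub>m nz @\<^sub>c 0\<^sub>m nz ne) @\<^sub>r
     (1\<^sub>m n @\<^sub>c 0\<^sub>m n nz' @\<^sub>c 0\<^sub>m n nz @\<^sub>c 0\<^sub>m n ne) @\<^sub>r
     (0\<^sub>m ne n @\<^sub>c 0\<^sub>m ne nz' @\<^sub>c 0\<^sub>m ne nz @\<^sub>c 1\<^sub>m ne) @\<^sub>r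
     ((pBd G)\<^sup>T @\<^sub>c 0\<^sub>m nd nz' @\<^sub>c 0\<^sub>m nd nz @\<^sub>c (pDed G)\<^sup>T)"

section \<open>Stability and performance\<close>

definition vec_norm :: "real vec \<Rightarrow> real" where
  "vec_norm v = sqrt (v \<bullet> v)"

text \<open>Global asymptotic stability of the origin (Lyapunov stability and global attractivity).\<close>

definition glob_asymp_stable :: "nat \<Rightarrow> (real vec \<Rightarrow> nat \<Rightarrow> real vec) \<Rightarrow> bool" where
  "glob_asymp_stable n \<phi> \<longleftrightarrow>
     (\<forall>\<epsilon>>0. \<exists>\<delta>>0. \<forall>x0 \<in> carrier_vec n. vec_norm x0 < \<delta> \<longrightarrow> (\<forall>k. vec_norm (\<phi> x0 k) < \<epsilon>))
     \<and> (\<forall>x0 \<in> carrier_vec n. (\<lambda>k. vec_norm (\<phi> x0 k)) \<longlonglongrightarrow> 0)"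

text \<open>Stability refers to the closed loop without external disturbance, \<open>d = 0\<close>.\<close>

definition robustly_stable ::
  "plant \<Rightarrow> real mat \<Rightarrow> nat \<Rightarrow> nat \<Rightarrow> real mat set \<Rightarrow> (real vec \<Rightarrow> real mat) set \<Rightarrow> bool" where
  "robustly_stable G K n nd DL DN \<longleftrightarrow>
     (\<forall>\<Delta>\<in>DL. \<forall>\<Delta>'\<in>DN. glob_asymp_stable n (\<lambda>x0. cl_state G K \<Delta> \<Delta>' x0 (\<lambda>_. 0\<^sub>v nd)))"

definition square_summable :: "nat \<Rightarrow> (nat \<Rightarrow> real vec) \<Rightarrow> bool" where
  "square_summable nd d \<longleftrightarrow> (\<forall>k. d k \<in> carrier_vec nd) \<and> summable (\<lambda>k. d k \<bullet> d k)"

text \<open>As usual for input-output performance, the initial state is zero. Convergence of the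
  series is part of the claim.\<close>

definition robust_quadratic_performance ::
  "plant \<Rightarrow> real mat \<Rightarrow> nat \<Rightarrow> nat \<Rightarrow> real mat set \<Rightarrow> (real vec \<Rightarrow> real mat) set \<Rightarrow> real mat \<Rightarrow> bool" where
  "robust_quadratic_performance G K n nd DL DN Pp \<longleftrightarrow>
     (\<exists>\<epsilon>>0. \<forall>d. square_summable nd d \<longrightarrow> (\<forall>\<Delta>\<in>DL. \<forall>\<Delta>'\<in>DN.
        let s = (\<lambda>k. let v = d k @\<^sub>v cl_out G K \<Delta> \<Delta>' (0\<^sub>v n) d k in v \<bullet> (Pp *\<^sub>v v))
        in summable s \<and> suminf s \<le> - \<epsilon> * (\<Sum>k. d k \<bullet> d k)))"

end

theory Submission
  imports Defs
begin

text \<open>With \<open>p = \<Delta>\<^sup>T B\<^sub>w\<^sup>T \<xi>\<close> and \<open>p' = \<Delta>'(x)\<^sup>T (B\<^sub>w'\<^sup>T \<xi> + D\<^sub>z\<^sub>w'\<^sup>T p)\<close>, evaluating the synthesis inequality at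
  \<open>(\<xi>, p', p, \<eta>)\<close> makes the multiplier terms nonnegative and leaves a dissipation inequality for
  the adjoint of the closed loop. The vector \<open>a\<close> produced by the second block row of the outer factor
  and \<open>q = B\<^sub>d\<^sup>T \<xi> + D\<^sub>e\<^sub>d\<^sup>T \<eta>\<close> satisfy \<open>a \<bullet> x + q \<bullet> d = \<xi> \<bullet> x\<^sub>+ + \<eta> \<bullet> e\<close>.

  Put \<open>X = Y\<^sup>-\<^sup>1\<close> and choose \<open>\<xi> = X x\<^sub>+\<close> and \<open>\<eta> = S\<^sub>p\<^sup>T d + R\<^sub>p e\<close>. Then the primal dissipation expression
  for the storage function \<open>x \<bullet> X x\<close> equals the dual one plus \<open>- u \<bullet> Y u + v \<bullet> Q v\<close> with
  \<open>u = a - X x\<close>, \<open>v = Q\<^sub>p d + S\<^sub>p e + q\<close> and \<open>Q\<close> the left upper block of the inverse index, so it is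
  negative; unlike in the usual dualization lemma, no inertia count is needed. With \<open>\<eta> = 0\<close> and the
  slack of the strict inequality the same choice gives \<open>V(x\<^sub>+) \<le> \<rho> V(x) + c |d|\<^sup>2\<close> with \<open>\<rho> < 1\<close>. All
  constants come from the matrix inequality alone, hence are uniform in the uncertainties.\<close>

section \<open>Quadratic forms\<close>

definition quad_form :: "real mat \<Rightarrow> real vec \<Rightarrow> real" where
  "quad_form A v = v \<bullet> (A *\<^sub>v v)"

lemma quad_form_congruence:
  assumes "H \<in> carrier_mat p p" "F \<in> carrier_mat p q" "v \<in> carrier_vec q"
  shows "quad_form (F\<^sup>T * H * F) v = quad_form H (F *\<^sub>v v)"
proof -
  have "(F\<^sup>T * H * F) *\<^sub>v v = F\<^sup>T *\<^sub>v (H *\<^sub>v (F *\<^sub>v v))"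
    using assms by (simp add: assoc_mult_mat_vec[of _ q p _ q] assoc_mult_mat_vec[of _ q p _ p])
  moreover have "v \<bullet> (F\<^sup>T *\<^sub>v (H *\<^sub>v (F *\<^sub>v v))) = (F *\<^sub>v v) \<bullet> (H *\<^sub>v (F *\<^sub>v v))"
    using assms transpose_vec_mult_scalar[of "F\<^sup>T" q p "H *\<^sub>v (F *\<^sub>v v)" v] by simp
  ultimately show ?thesis
    by (simp add: quad_form_def)
qed

lemma sym_mat_scalar_prod:
  assumes "sym_mat n A" "u \<in> carrier_vec n" "v \<in> carrier_vec n"
  shows "u \<bullet> (A *\<^sub>v v) = v \<bullet> (A *\<^sub>v u)"
proof -
  have A: "A \<in> carrier_mat n n" "A\<^sup>T = A"
    using assms by (auto simp: sym_mat_def)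
  have "u \<bullet> (A *\<^sub>v v) = (A\<^sup>T *\<^sub>v u) \<bullet> v"
    using transpose_vec_mult_scalar[OF A(1) assms(3,2)] by simp
  also have "\<dots> = v \<bullet> (A *\<^sub>v u)"
    using A assms by (simp add: comm_scalar_prod[of _ n])
  finally show ?thesis .
qed

lemma scalar_prod_mult_mat_vec_sum:
  assumes "A \<in> carrier_mat p q" "u \<in> carrier_vec p" "v \<in> carrier_vec q"
  shows "u \<bullet> (A *\<^sub>v v) = (\<Sum>i<p. \<Sum>j<q. u $ i * (A $$ (i, j) * v $ j))"
  using assms by (auto simp: scalar_prod_def sum_distrib_left lessThan_atLeast0 intro!: sum.cong)

lemma quad_form_add:
  assumes "sym_mat n A" "u \<in> carrier_vec n" "v \<in> carrier_vec n"
  shows "quad_form A (u + v) = quad_form A u + 2 * (u \<bullet> (A *\<^sub>v v)) + quad_form A v"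
proof -
  have A: "A \<in> carrier_mat n n"
    using assms by (auto simp: sym_mat_def)
  have c: "A *\<^sub>v u \<in> carrier_vec n" "A *\<^sub>v v \<in> carrier_vec n"
    using A assms by auto
  show ?thesis
    unfolding quad_form_def using assms A c sym_mat_scalar_prod[OF assms]
    by (simp add: mult_add_distrib_mat_vec[of _ n n] scalar_prod_add_distrib[of _ n]
        add_scalar_prod_distrib[of _ n])
qed

lemma quad_form_smult:
  assumes "A \<in> carrier_mat n n" "v \<in> carrier_vec n"
  shows "quad_form A (c \<cdot>\<^sub>v v) = c\<^sup>2 * quad_form A v"
  using assms by (simp add: quad_form_def mult_mat_vec[of _ n n] power2_eq_square)

lemma quad_form_minus:
  assumes "sym_mat n A" "u \<in> carrier_vec n" "v \<in> carrier_vec n"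
  shows "quad_form A (u - v) = quad_form A u - 2 * (u \<bullet> (A *\<^sub>v v)) + quad_form A v"
proof -
  have A: "A \<in> carrier_mat n n"
    using assms by (auto simp: sym_mat_def)
  have e: "u - v = u + (-1) \<cdot>\<^sub>v v"
    using assms by auto
  show ?thesis
    unfolding e using assms A
    by (subst quad_form_add[of n]) (auto simp: quad_form_smult[of _ n] mult_mat_vec[of _ n n])
qed

lemma quad_form_uminus_mat:
  assumes "A \<in> carrier_mat n n" "v \<in> carrier_vec n"
  shows "quad_form (- A) v = - quad_form A v"
  using assms by (simp add: quad_form_def)

lemma quad_form_one: "v \<in> carrier_vec n \<Longrightarrow> quad_form (1\<^sub>m n) v = v \<bullet> v"
  by (simp add: quad_form_def)

lemma scalar_prod_self_nonneg: "(v :: real vec) \<bullet> v \<ge> 0"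
  by (auto simp: scalar_prod_def intro: sum_nonneg)

lemma quad_form_append:
  assumes "A \<in> carrier_mat p p" "B \<in> carrier_mat p q" "D \<in> carrier_mat q q"
    and "u \<in> carrier_vec p" "v \<in> carrier_vec q"
  shows "quad_form (four_block_mat A B (B\<^sup>T) D) (u @\<^sub>v v)
    = quad_form A u + 2 * (u \<bullet> (B *\<^sub>v v)) + quad_form D v"
proof -
  have "v \<bullet> (B\<^sup>T *\<^sub>v u) = u \<bullet> (B *\<^sub>v v)"
    using assms transpose_vec_mult_scalar[of B p q v u]
    by (simp add: comm_scalar_prod[of v q])
  then show ?thesis
    using assms unfolding quad_form_def
    by (simp add: four_block_mat_mult_vec[of _ p p _ q _ q] scalar_prod_append[of _ p _ q]
        scalar_prod_add_distrib[of _ p] scalar_prod_add_distrib[of _ q])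
qed

lemma quad_form_append_diag:
  assumes "A \<in> carrier_mat p p" "D \<in> carrier_mat q q"
    and "u \<in> carrier_vec p" "v \<in> carrier_vec q"
  shows "quad_form (four_block_mat A (0\<^sub>m p q) (0\<^sub>m q p) D) (u @\<^sub>v v)
    = quad_form A u + quad_form D v"
proof -
  have "0\<^sub>m p q *\<^sub>v v = 0\<^sub>v p"
    using assms by auto
  then show ?thesis
    using quad_form_append[of A p "0\<^sub>m p q" q D u v] assms by simp
qed

section \<open>Bounds for quadratic forms and linear maps by the squared length\<close>

lemma quad_form_bound:
  assumes "A \<in> carrier_mat n n"
  obtains C where "C > 0" "\<And>v. v \<in> carrier_vec n \<Longrightarrow> \<bar>quad_form A v\<bar> \<le> C * (v \<bullet> v)"
proof
  \<comment> \<open>Every product of two coordinates is at most v . v in absolute value, so the sum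
    of the absolute entries is an admissible constant. The added 1 keeps it positive when the matrix
    is zero or empty.\<close>
  define C where "C = (\<Sum>i<n. \<Sum>j<n. \<bar>A $$ (i, j)\<bar>) + 1"
  show "C > 0"
    unfolding C_def by (intro add_nonneg_pos sum_nonneg) auto
  fix v :: "real vec" assume v: "v \<in> carrier_vec n"
  have comp: "(v $ i)\<^sup>2 \<le> v \<bullet> v" if "i < n" for i
    using that v member_le_sum[of i "{0..<n}" "\<lambda>i. (v $ i)\<^sup>2"]
    by (simp add: scalar_prod_def power2_eq_square)
  \<comment> \<open>From 2 |v_i| |v_j| <= v_i^2 + v_j^2, where each square is at most v . v.\<close>
  have prod: "\<bar>v $ i * v $ j\<bar> \<le> v \<bullet> v" if "i < n" "j < n" for i j
    using comp[OF that(1)] comp[OF that(2)] sum_squares_bound[of "\<bar>v $ i\<bar>" "\<bar>v $ j\<bar>"]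
    by (simp add: abs_mult)
  have "\<bar>quad_form A v\<bar> \<le> (\<Sum>i<n. \<Sum>j<n. \<bar>v $ i * (A $$ (i, j) * v $ j)\<bar>)"
    unfolding quad_form_def scalar_prod_mult_mat_vec_sum[OF assms v v]
    by (rule order_trans[OF sum_abs]) (intro sum_mono sum_abs)
  also have "\<dots> \<le> (\<Sum>i<n. \<Sum>j<n. \<bar>A $$ (i, j)\<bar> * (v \<bullet> v))"
  proof (intro sum_mono)
    fix i j assume "i \<in> {..<n}" "j \<in> {..<n}"
    then have "\<bar>A $$ (i, j)\<bar> * \<bar>v $ i * v $ j\<bar> \<le> \<bar>A $$ (i, j)\<bar> * (v \<bullet> v)"
      by (intro mult_left_mono prod) auto
    then show "\<bar>v $ i * (A $$ (i, j) * v $ j)\<bar> \<le> \<bar>A $$ (i, j)\<bar> * (v \<bullet> v)"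
      by (simp add: abs_mult mult_ac)
  qed
  also have "\<dots> \<le> C * (v \<bullet> v)"
    using scalar_prod_self_nonneg[of v] by (simp add: C_def sum_distrib_right distrib_right)
  finally show "\<bar>quad_form A v\<bar> \<le> C * (v \<bullet> v)" .
qed

lemma mult_mat_vec_bound:
  fixes A :: "real mat"
  assumes "A \<in> carrier_mat p q"
  obtains C where "C > 0"
    "\<And>v. v \<in> carrier_vec q \<Longrightarrow> (A *\<^sub>v v) \<bullet> (A *\<^sub>v v) \<le> C * (v \<bullet> v)"
proof -
  \<comment> \<open>The squared length of A v is the form of the Gram matrix of A. The identity in
    the middle brings this matrix into the shape of \<open>quad_form_congruence\<close>.\<close>
  obtain C where C: "C > 0"
    "\<And>v. v \<in> carrier_vec q \<Longrightarrow> \<bar>quad_form (A\<^sup>T * 1\<^sub>m p * A) v\<bar> \<le> C * (v \<bullet> v)"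
    using quad_form_bound[of "A\<^sup>T * 1\<^sub>m p * A" q] assms by auto
  show thesis
  proof (rule that[OF C(1)])
    fix v :: "real vec" assume v: "v \<in> carrier_vec q"
    have "quad_form (A\<^sup>T * 1\<^sub>m p * A) v = (A *\<^sub>v v) \<bullet> (A *\<^sub>v v)"
      using assms v by (subst quad_form_congruence[of _ p _ q]) (auto simp: quad_form_one[of _ p])
    then show "(A *\<^sub>v v) \<bullet> (A *\<^sub>v v) \<le> C * (v \<bullet> v)"
      using C(2)[OF v] by simp
  qed
qed

text \<open>A polynomial with c > 0 is tested at its minimiser - b / c. For c = 0 it is affine, so
  its slope vanishes, and c < 0 is impossible because the value is negative at a large t.\<close>

lemma nonneg_quadratic_discriminant:
  fixes a b c :: real
  assumes "\<And>t. a + 2 * b * t + c * t\<^sup>2 \<ge> 0"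
  shows "b\<^sup>2 \<le> a * c"
proof (cases "c = 0")
  case True
  \<comment> \<open>If b were nonzero, the value of the affine polynomial at this point would be
    -1.\<close>
  have "b = 0"
    using assms[of "- (a + 1) / (2 * b)"] True by (cases "b = 0") auto
  then show ?thesis using True by simp
next
  case False
  have c: "c > 0"
  proof (rule ccontr)
    assume "\<not> c > 0"
    then have c: "c < 0" using False by simp
    \<comment> \<open>This point satisfies c t = c - 2 |b| - |a|, so the slope 2 b is absorbed.
      Together with t >= 1 the value of the polynomial is then at most a + c - |a| < 0.\<close>
    define t where "t = 1 + (2 * \<bar>b\<bar> + \<bar>a\<bar>) / (- c)"
    have "(2 * \<bar>b\<bar> + \<bar>a\<bar>) / (- c) \<ge> 0"
      using c by (intro divide_nonneg_pos) auto
    then have t: "t \<ge> 1" "c * t = - 2 * \<bar>b\<bar> + c - \<bar>a\<bar>"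
      using c by (auto simp: t_def field_simps)
    have "a + 2 * b * t + c * t\<^sup>2 = a + (2 * b + c * t) * t"
      by (simp add: power2_eq_square algebra_simps)
    also have "\<dots> \<le> a + (c - \<bar>a\<bar>) * t"
      using t by (intro add_left_mono mult_right_mono) auto
    also have "\<dots> \<le> a + (c - \<bar>a\<bar>) * 1"
      using c t by (intro add_left_mono mult_left_mono_neg) auto
    also have "\<dots> < 0" using c by auto
    finally show False using assms[of t] by simp
  qed
  have "a + 2 * b * (- b / c) + c * (- b / c)\<^sup>2 = a - b\<^sup>2 / c"
    using c by (simp add: field_simps power2_eq_square)
  then have "b\<^sup>2 / c \<le> a" using assms[of "- b / c"] by simp
  then show ?thesis using c by (simp add: field_simps)
qed

section \<open>Cauchy-Schwarz, inverses and bounds for semidefinite matrices\<close>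

lemma pos_semidef_quad_form:
  "pos_semidef n A \<Longrightarrow> v \<in> carrier_vec n \<Longrightarrow> quad_form A v \<ge> 0"
  by (auto simp: pos_semidef_def quad_form_def)

lemma pos_def_imp_pos_semidef: "pos_def n A \<Longrightarrow> pos_semidef n A"
  unfolding pos_def_def pos_semidef_def sym_mat_def
  by (metis less_eq_real_def mult_mat_vec_carrier scalar_prod_left_zero)

text \<open>The form along the line u + t v is a nonnegative quadratic polynomial in t, and the
  inequality is its discriminant condition.\<close>

lemma pos_semidef_Cauchy_Schwarz:
  assumes "pos_semidef n A" "u \<in> carrier_vec n" "v \<in> carrier_vec n"
  shows "(u \<bullet> (A *\<^sub>v v))\<^sup>2 \<le> quad_form A u * quad_form A v"
proof (rule nonneg_quadratic_discriminant)
  fix t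
  have A: "sym_mat n A" "A \<in> carrier_mat n n"
    using assms by (auto simp: pos_semidef_def sym_mat_def)
  have "0 \<le> quad_form A (u + t \<cdot>\<^sub>v v)"
    using assms by (intro pos_semidef_quad_form) auto
  also have "\<dots> = quad_form A u + 2 * (u \<bullet> (A *\<^sub>v v)) * t + quad_form A v * t\<^sup>2"
    using assms A by (subst quad_form_add[of n])
      (auto simp: quad_form_smult[of _ n] mult_mat_vec[of _ n n])
  finally show "quad_form A u + 2 * (u \<bullet> (A *\<^sub>v v)) * t + quad_form A v * t\<^sup>2 \<ge> 0" .
qed

text \<open>The transpose of B is a left inverse of the symmetric matrix A, and a left inverse
  coincides with the right inverse B.\<close>

lemma sym_mat_inverse:
  assumes A: "sym_mat n A" and B: "B \<in> carrier_mat n n" and AB: "A * B = 1\<^sub>m n" "B * A = 1\<^sub>m n"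
  shows "sym_mat n B"
proof -
  have A': "A \<in> carrier_mat n n" "A\<^sup>T = A"
    using A by (auto simp: sym_mat_def)
  have "B\<^sup>T * A = 1\<^sub>m n"
    using transpose_mult[of A n n B n] A' B AB by simp
  then have "B\<^sup>T * A * B = B" using B by simp
  moreover have "B\<^sup>T * A * B = B\<^sup>T"
    using A' B AB by (simp add: assoc_mult_mat[of _ n n _ n _ n])
  ultimately show ?thesis using B by (simp add: sym_mat_def)
qed

text \<open>A nonzero kernel vector would violate positivity, so the determinant is nonzero. The
  form of the inverse B at v equals the form of A at B v, and B v is nonzero because A maps it back
  to v.\<close>

lemma pos_def_inverse:
  assumes "pos_def n A"
  obtains B where "pos_def n B" "A * B = 1\<^sub>m n" "B * A = 1\<^sub>m n"
proof -
  have A: "sym_mat n A" "A \<in> carrier_mat n n"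
    using assms by (auto simp: pos_def_def sym_mat_def)
  have "det A \<noteq> 0"
  proof
    assume "det A = 0"
    then obtain v where v: "v \<in> carrier_vec n" "v \<noteq> 0\<^sub>v n" "A *\<^sub>v v = 0\<^sub>v n"
      using det_0_iff_vec_prod_zero_field[OF A(2)] by auto
    then have "v \<bullet> (A *\<^sub>v v) > 0" using assms by (auto simp: pos_def_def)
    then show False using v by simp
  qed
  then obtain B where B: "B \<in> carrier_mat n n" "A * B = 1\<^sub>m n" "B * A = 1\<^sub>m n"
    using det_non_zero_imp_unit[OF A(2), of undefined]
    by (auto simp: Units_def ring_mat_def)
  have sB: "sym_mat n B" by (rule sym_mat_inverse[OF A(1) B])
  have "pos_def n B"
    unfolding pos_def_def
  proof (intro conjI sB ballI impI)
    fix v :: "real vec" assume v: "v \<in> carrier_vec n" "v \<noteq> 0\<^sub>v n"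
    have Av: "A *\<^sub>v (B *\<^sub>v v) = v"
      using A B v by (simp add: assoc_mult_mat_vec[symmetric, of _ n n _ n])
    have "B *\<^sub>v v \<noteq> 0\<^sub>v n"
    proof
      assume "B *\<^sub>v v = 0\<^sub>v n"
      then have "v = A *\<^sub>v 0\<^sub>v n" using Av by simp
      then show False using A v by auto
    qed
    then have "(B *\<^sub>v v) \<bullet> (A *\<^sub>v (B *\<^sub>v v)) > 0"
      using assms v B by (auto simp: pos_def_def)
    then show "v \<bullet> (B *\<^sub>v v) > 0"
      using Av v B by (simp add: comm_scalar_prod[of _ n])
  qed
  then show thesis using that B by blast
qed

text \<open>An algebraic substitute for compactness of the unit sphere: Cauchy-Schwarz for A,
  applied to v and B v with B the inverse, gives (v . v)^2 <= (v . A v) (v . B v). Bounding the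
  second factor by C (v . v) leaves the constant 1 / C.\<close>

lemma pos_def_lower_bound:
  assumes "pos_def n A"
  obtains c where "c > 0" "\<And>v. v \<in> carrier_vec n \<Longrightarrow> c * (v \<bullet> v) \<le> quad_form A v"
proof -
  obtain B where B: "pos_def n B" "A * B = 1\<^sub>m n" "B * A = 1\<^sub>m n"
    using pos_def_inverse[OF assms] .
  have c: "A \<in> carrier_mat n n" "B \<in> carrier_mat n n"
    using assms B by (auto simp: pos_def_def sym_mat_def)
  obtain C where C: "C > 0" "\<And>v. v \<in> carrier_vec n \<Longrightarrow> \<bar>quad_form B v\<bar> \<le> C * (v \<bullet> v)"
    using quad_form_bound[OF c(2)] by blast
  show thesis
  proof (rule that[of "1 / C"])
    show "1 / C > 0" using C by simp
    fix v :: "real vec" assume v: "v \<in> carrier_vec n"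
    have Av: "A *\<^sub>v (B *\<^sub>v v) = v"
      using c B v by (simp add: assoc_mult_mat_vec[symmetric, of _ n n _ n])
    have "(v \<bullet> v)\<^sup>2 \<le> quad_form A v * quad_form A (B *\<^sub>v v)"
      using pos_semidef_Cauchy_Schwarz[OF pos_def_imp_pos_semidef[OF assms] v, of "B *\<^sub>v v"]
        Av c v by simp
    also have "quad_form A (B *\<^sub>v v) = quad_form B v"
      using Av v c by (simp add: quad_form_def comm_scalar_prod[of _ n])
    also have "quad_form A v * quad_form B v \<le> quad_form A v * (C * (v \<bullet> v))"
      using C(2)[OF v] pos_semidef_quad_form[OF pos_def_imp_pos_semidef[OF assms] v]
      by (intro mult_left_mono) auto
    finally have le: "(v \<bullet> v) * (v \<bullet> v) \<le> (C * quad_form A v) * (v \<bullet> v)"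
      by (simp add: power2_eq_square mult_ac)
    have "v \<bullet> v \<le> C * quad_form A v"
    proof (cases "v \<bullet> v = 0")
      case True
      then show ?thesis
        using C pos_semidef_quad_form[OF pos_def_imp_pos_semidef[OF assms] v] by simp
    next
      case False
      then have "v \<bullet> v > 0" using scalar_prod_self_nonneg[of v] by simp
      then show ?thesis using le by (rule mult_right_le_imp_le[rotated])
    qed
    then show "1 / C * (v \<bullet> v) \<le> quad_form A v" using C by (simp add: field_simps)
  qed
qed

text \<open>A small value of a semidefinite form forces a small image vector, even though the vector
  itself may be large. Cauchy-Schwarz with first argument A v gives |A v|^4 <= C |A v|^2 (v . A v),
  and one factor |A v|^2 cancels.\<close>

lemma pos_semidef_image_bound:
  assumes "pos_semidef n A"
  obtains C where "C > 0"
    "\<And>v. v \<in> carrier_vec n \<Longrightarrow> (A *\<^sub>v v) \<bullet> (A *\<^sub>v v) \<le> C * quad_form A v"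
proof -
  have A: "A \<in> carrier_mat n n" "sym_mat n A"
    using assms by (auto simp: pos_semidef_def sym_mat_def)
  obtain C where C: "C > 0" "\<And>v. v \<in> carrier_vec n \<Longrightarrow> \<bar>quad_form A v\<bar> \<le> C * (v \<bullet> v)"
    using quad_form_bound[OF A(1)] by blast
  show thesis
  proof (rule that[OF C(1)])
    fix v :: "real vec" assume v: "v \<in> carrier_vec n"
    have w: "A *\<^sub>v v \<in> carrier_vec n" using A v by simp
    let ?s = "(A *\<^sub>v v) \<bullet> (A *\<^sub>v v)"
    have pv: "quad_form A v \<ge> 0" by (rule pos_semidef_quad_form[OF assms v])
    have "?s\<^sup>2 \<le> quad_form A (A *\<^sub>v v) * quad_form A v"
      by (rule pos_semidef_Cauchy_Schwarz[OF assms w v])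
    also have "\<dots> \<le> (C * ?s) * quad_form A v"
      using C(2)[OF w] pv by (intro mult_right_mono) auto
    finally have le: "?s * ?s \<le> (C * quad_form A v) * ?s"
      by (simp add: power2_eq_square mult_ac)
    show "?s \<le> C * quad_form A v"
    proof (cases "?s = 0")
      case True
      then show ?thesis using C pv by simp
    next
      case False
      then have "?s > 0" using scalar_prod_self_nonneg[of "A *\<^sub>v v"] by simp
      then show ?thesis using le by (rule mult_right_le_imp_le[rotated])
    qed
  qed
qed

lemma scalar_prod_add_self_le:
  fixes u v :: "real vec"
  assumes "u \<in> carrier_vec n" "v \<in> carrier_vec n"
  shows "(u + v) \<bullet> (u + v) \<le> 2 * (u \<bullet> u) + 2 * (v \<bullet> v)"
proof -
  have I: "sym_mat n (1\<^sub>m n)" by (simp add: sym_mat_def)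
  have "0 \<le> quad_form (1\<^sub>m n) (u - v)"
    using assms scalar_prod_self_nonneg by (simp add: quad_form_one[of _ n])
  then show ?thesis
    using quad_form_minus[OF I assms] quad_form_add[OF I assms] assms
    by (simp add: quad_form_one[of _ n])
qed

lemma quad_form_add_mat:
  assumes "A \<in> carrier_mat n n" "B \<in> carrier_mat n n" "v \<in> carrier_vec n"
  shows "quad_form (A + B) v = quad_form A v + quad_form B v"
  using assms by (simp add: quad_form_def add_mult_distrib_mat_vec[of _ n n]
      scalar_prod_add_distrib[of _ n])

lemma quad_form_mat_sum:
  assumes "\<And>k. k \<in> I \<Longrightarrow> T k \<in> carrier_mat n n" "v \<in> carrier_vec n"
  shows "quad_form (mat_sum n n T I) v = (\<Sum>k\<in>I. quad_form (T k) v)"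
proof -
  have "quad_form (mat_sum n n T I) v = (\<Sum>i<n. \<Sum>j<n. \<Sum>k\<in>I. v $ i * (T k $$ (i, j) * v $ j))"
    unfolding quad_form_def
    using assms scalar_prod_mult_mat_vec_sum[of "mat_sum n n T I" n n v v]
    by (simp add: mat_sum_def sum_distrib_left sum_distrib_right)
  also have "\<dots> = (\<Sum>k\<in>I. \<Sum>i<n. \<Sum>j<n. v $ i * (T k $$ (i, j) * v $ j))"
    by (simp add: sum.swap[of _ I])
  also have "\<dots> = (\<Sum>k\<in>I. quad_form (T k) v)"
    unfolding quad_form_def
    using assms scalar_prod_mult_mat_vec_sum[of "T k" n n v v for k] by simp
  finally show ?thesis .
qed

section \<open>Dualization\<close>

lemma neg_semidef_sym_mat:
  assumes "neg_semidef n A" shows "sym_mat n A"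
proof -
  have "(- A) \<in> carrier_mat n n" "(- A)\<^sup>T = - A"
    using assms by (auto simp: neg_semidef_def pos_semidef_def sym_mat_def)
  then have "A \<in> carrier_mat n n" "- (A\<^sup>T) = - A"
    by (auto simp: transpose_uminus)
  then show ?thesis
    by (metis sym_mat_def uminus_uminus_mat)
qed

lemma neg_semidef_quad_form:
  "neg_semidef n A \<Longrightarrow> v \<in> carrier_vec n \<Longrightarrow> quad_form A v \<le> 0"
  using pos_semidef_quad_form[of n "- A" v] quad_form_uminus_mat[of A n v]
    neg_semidef_sym_mat[of n A]
  by (auto simp: neg_semidef_def sym_mat_def)

text \<open>The setting for passing from the adjoint system to the primal one. \<open>Y\<close> is
  the matrix of the synthesis inequality and \<open>X\<close> is its inverse, the weight of the
  primal storage function. \<open>Qt\<close>, \<open>St\<close>, \<open>Rt\<close> are the blocks of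
  the inverse performance index.\<close>

locale dual_pair =
  fixes n nd ne :: nat and X Y Qp Sp Rp Qt St Rt :: "real mat"
  assumes X_pos: "pos_def n X" and Y_pos: "pos_def n Y" and YX: "Y * X = 1\<^sub>m n"
    and Pp_blocks: "Qp \<in> carrier_mat nd nd" "Sp \<in> carrier_mat nd ne" "Rp \<in> carrier_mat ne ne"
    and Pt_blocks: "Qt \<in> carrier_mat nd nd" "St \<in> carrier_mat nd ne" "Rt \<in> carrier_mat ne ne"
    and Pp_inv: "inverts_mat (four_block_mat Qt St (St\<^sup>T) Rt) (four_block_mat Qp Sp (Sp\<^sup>T) Rp)"
    and Qt_neg: "neg_semidef nd Qt"
begin

abbreviation "Pp \<equiv> four_block_mat Qp Sp (Sp\<^sup>T) Rp"
text \<open>The index of the adjoint system, acting on pairs (\<eta>, q): the inverse index with its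
  blocks swapped and the diagonal ones negated.\<close>

abbreviation "Ptp \<equiv> four_block_mat (- Rt) (St\<^sup>T) St (- Qt)"

lemma XY_carrier: "X \<in> carrier_mat n n" "Y \<in> carrier_mat n n" "sym_mat n X" "sym_mat n Y"
  using X_pos Y_pos by (auto simp: pos_def_def sym_mat_def)

lemma YX_cancel: "v \<in> carrier_vec n \<Longrightarrow> Y *\<^sub>v (X *\<^sub>v v) = v"
  using XY_carrier YX by (simp add: assoc_mult_mat_vec[symmetric, of _ n n _ n])

lemma quad_form_Y_X: "v \<in> carrier_vec n \<Longrightarrow> quad_form Y (X *\<^sub>v v) = quad_form X v"
  using XY_carrier YX_cancel by (simp add: quad_form_def comm_scalar_prod[of _ n])

lemma Ptp_quad_form:
  assumes "\<eta> \<in> carrier_vec ne" "q \<in> carrier_vec nd"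
  shows "quad_form Ptp (\<eta> @\<^sub>v q) = - quad_form Rt \<eta> + 2 * (q \<bullet> (St *\<^sub>v \<eta>)) - quad_form Qt q"
proof -
  have "(St\<^sup>T *\<^sub>v q) \<bullet> \<eta> = q \<bullet> (St *\<^sub>v \<eta>)"
    using Pt_blocks assms transpose_vec_mult_scalar[of St nd ne \<eta> q] by simp
  then have "\<eta> \<bullet> (St\<^sup>T *\<^sub>v q) = q \<bullet> (St *\<^sub>v \<eta>)"
    using Pt_blocks assms by (simp add: comm_scalar_prod[of \<eta> ne])
  then show ?thesis
    using quad_form_append[of "- Rt" ne "St\<^sup>T" nd "- Qt" \<eta> q] Pt_blocks assms
    by (simp add: quad_form_uminus_mat[of _ ne] quad_form_uminus_mat[of _ nd])
qed

text \<open>The blocks t and \<eta> of the index applied to (d, e) serve as new coordinates: the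
  inverse index recovers d and e from them, and \<eta> is the vector at which the adjoint inequality
  gets tested.\<close>

lemma inverse_index_vec:
  assumes "d \<in> carrier_vec nd" "e \<in> carrier_vec ne"
  defines "t \<equiv> Qp *\<^sub>v d + Sp *\<^sub>v e" and "\<eta> \<equiv> Sp\<^sup>T *\<^sub>v d + Rp *\<^sub>v e"
  shows "Pp *\<^sub>v (d @\<^sub>v e) = t @\<^sub>v \<eta>" "Qt *\<^sub>v t + St *\<^sub>v \<eta> = d" "St\<^sup>T *\<^sub>v t + Rt *\<^sub>v \<eta> = e"
proof -
  have c: "t \<in> carrier_vec nd" "\<eta> \<in> carrier_vec ne"
    using Pp_blocks assms by (auto simp: t_def \<eta>_def)
  show P: "Pp *\<^sub>v (d @\<^sub>v e) = t @\<^sub>v \<eta>"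
    unfolding t_def \<eta>_def using Pp_blocks assms
    by (intro four_block_mat_mult_vec[of _ nd nd _ ne _ ne]) auto
  let ?Pt = "four_block_mat Qt St (St\<^sup>T) Rt"
  have cP: "?Pt \<in> carrier_mat (nd + ne) (nd + ne)" "Pp \<in> carrier_mat (nd + ne) (nd + ne)"
    using Pt_blocks Pp_blocks by auto
  then have "?Pt * Pp = 1\<^sub>m (nd + ne)"
    using Pp_inv Pt_blocks by (simp add: inverts_mat_def)
  then have "d @\<^sub>v e = ?Pt *\<^sub>v (Pp *\<^sub>v (d @\<^sub>v e))"
    using cP assms by (simp add: assoc_mult_mat_vec[symmetric, of _ "nd + ne" "nd + ne" _ "nd + ne"])
  also have "\<dots> = (Qt *\<^sub>v t + St *\<^sub>v \<eta>) @\<^sub>v (St\<^sup>T *\<^sub>v t + Rt *\<^sub>v \<eta>)"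
    unfolding P using Pt_blocks c by (intro four_block_mat_mult_vec[of _ nd nd _ ne _ ne]) auto
  finally have "d = Qt *\<^sub>v t + St *\<^sub>v \<eta> \<and> e = St\<^sup>T *\<^sub>v t + Rt *\<^sub>v \<eta>"
    using append_vec_eq[of d nd "Qt *\<^sub>v t + St *\<^sub>v \<eta>"] assms Pt_blocks c by auto
  then show "Qt *\<^sub>v t + St *\<^sub>v \<eta> = d" "St\<^sup>T *\<^sub>v t + Rt *\<^sub>v \<eta> = e" by auto
qed

text \<open>Both squares on the right are expanded, and the adjoint relation replaces 2 (a . x + q .
  d) by 2 (\<xi> . xp + \<eta> . e). The \<open>Y\<close> terms in a and the \<open>Qt\<close> terms
  in q cancel. What remains in t and \<eta> is the form of \<open>Pp\<close>, by d = Qt t + St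
  \<eta> and its counterpart for e.\<close>

lemma dualization_identity:
  assumes x: "x \<in> carrier_vec n" and xp: "xp \<in> carrier_vec n"
    and d: "d \<in> carrier_vec nd" and e: "e \<in> carrier_vec ne"
    and a: "a \<in> carrier_vec n" and q: "q \<in> carrier_vec nd"
  defines "\<xi> \<equiv> X *\<^sub>v xp" and "t \<equiv> Qp *\<^sub>v d + Sp *\<^sub>v e" and "\<eta> \<equiv> Sp\<^sup>T *\<^sub>v d + Rp *\<^sub>v e"
  assumes adj: "a \<bullet> x + q \<bullet> d = \<xi> \<bullet> xp + \<eta> \<bullet> e"
  shows "quad_form X xp - quad_form X x + quad_form Pp (d @\<^sub>v e)
    = - quad_form Y (a - X *\<^sub>v x) + quad_form Qt (t + q)
      + (quad_form Y a - quad_form Y \<xi> + quad_form Ptp (\<eta> @\<^sub>v q))"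
proof -
  note inv = inverse_index_vec[OF d e, folded t_def \<eta>_def]
  have t: "t \<in> carrier_vec nd" and \<eta>: "\<eta> \<in> carrier_vec ne" and \<xi>: "\<xi> \<in> carrier_vec n"
    using Pp_blocks d e xp XY_carrier by (auto simp: t_def \<eta>_def \<xi>_def)
  have Qts: "sym_mat nd Qt" by (rule neg_semidef_sym_mat[OF Qt_neg])
  have Xx: "X *\<^sub>v x \<in> carrier_vec n" using XY_carrier x by simp
  have 1: "quad_form Y (a - X *\<^sub>v x) = quad_form Y a - 2 * (a \<bullet> x) + quad_form X x"
    using quad_form_minus[OF XY_carrier(4) a Xx] YX_cancel[OF x] quad_form_Y_X[OF x] by simp
  have 2: "quad_form Y \<xi> = quad_form X xp"
    unfolding \<xi>_def by (rule quad_form_Y_X[OF xp])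
  have 3: "\<xi> \<bullet> xp = quad_form X xp"
    using XY_carrier xp by (simp add: \<xi>_def quad_form_def comm_scalar_prod[of _ n])
  have 4: "quad_form Pp (d @\<^sub>v e) = d \<bullet> t + e \<bullet> \<eta>"
    unfolding quad_form_def inv using d e t \<eta> by (simp add: scalar_prod_append[of _ nd _ ne])
  have 5: "quad_form Qt (t + q) = quad_form Qt t + 2 * (q \<bullet> (Qt *\<^sub>v t)) + quad_form Qt q"
    using quad_form_add[OF Qts t q] sym_mat_scalar_prod[OF Qts t q] by simp
  have cs: "Qt *\<^sub>v t \<in> carrier_vec nd" "St *\<^sub>v \<eta> \<in> carrier_vec nd"
    "St\<^sup>T *\<^sub>v t \<in> carrier_vec ne" "Rt *\<^sub>v \<eta> \<in> carrier_vec ne"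
    using Pt_blocks t \<eta> by auto
  have 6: "q \<bullet> d = q \<bullet> (Qt *\<^sub>v t) + q \<bullet> (St *\<^sub>v \<eta>)"
    using inv(2) scalar_prod_add_distrib[OF q cs(1,2)] by simp
  have 7: "t \<bullet> d = quad_form Qt t + t \<bullet> (St *\<^sub>v \<eta>)"
    using inv(2) scalar_prod_add_distrib[OF t cs(1,2)] by (simp add: quad_form_def)
  have 8: "\<eta> \<bullet> e = t \<bullet> (St *\<^sub>v \<eta>) + quad_form Rt \<eta>"
    using inv(3) scalar_prod_add_distrib[OF \<eta> cs(3,4)]
      transpose_vec_mult_scalar[OF Pt_blocks(2) \<eta> t] comm_scalar_prod[OF \<eta> cs(3)]
    by (simp add: quad_form_def)
  have 9: "d \<bullet> t = t \<bullet> d" "e \<bullet> \<eta> = \<eta> \<bullet> e"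
    using comm_scalar_prod d e t \<eta> by blast+
  show ?thesis
    using 1 2 3 4 5 6 7 8 9 Ptp_quad_form[OF \<eta> q] adj by linarith
qed

text \<open>The identity gives a negative right-hand side; the task here is to extract a margin in d
  from it. With u = t + q one has d = Qt u + St \<eta> - Qt q. The first term is controlled by the
  discarded value of the form of - Qt at u, although this form is only semidefinite. The other two
  are controlled by \<epsilon> (|\<xi>|^2 + |\<eta>|^2), since q is linear in \<xi> and
  \<eta>.\<close>

lemma performance_dissipation:
  assumes B: "B \<in> carrier_mat n nd" and D: "D \<in> carrier_mat ne nd" and "\<epsilon> > 0"
  obtains \<gamma> where "\<gamma> > 0"
    "\<And>x xp d e a \<xi> \<eta> q. \<lbrakk>x \<in> carrier_vec n; xp \<in> carrier_vec n; d \<in> carrier_vec nd;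
      e \<in> carrier_vec ne; a \<in> carrier_vec n;
      \<xi> = X *\<^sub>v xp; \<eta> = Sp\<^sup>T *\<^sub>v d + Rp *\<^sub>v e; q = B\<^sup>T *\<^sub>v \<xi> + D\<^sup>T *\<^sub>v \<eta>;
      a \<bullet> x + q \<bullet> d = \<xi> \<bullet> xp + \<eta> \<bullet> e;
      - quad_form Y \<xi> + quad_form Y a + quad_form Ptp (\<eta> @\<^sub>v q) \<le> - \<epsilon> * (\<xi> \<bullet> \<xi> + \<eta> \<bullet> \<eta>)\<rbrakk>
      \<Longrightarrow> quad_form X xp - quad_form X x + quad_form Pp (d @\<^sub>v e) \<le> - \<gamma> * (d \<bullet> d)"
proof -
  let ?N = "- Qt"
  have N: "pos_semidef nd ?N" "?N \<in> carrier_mat nd nd"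
    using Qt_neg Pt_blocks by (auto simp: neg_semidef_def)
  obtain CN where CN: "CN > 0"
    "\<And>v. v \<in> carrier_vec nd \<Longrightarrow> (?N *\<^sub>v v) \<bullet> (?N *\<^sub>v v) \<le> CN * quad_form ?N v"
    using pos_semidef_image_bound[OF N(1)] by blast
  obtain CQ where CQ: "CQ > 0"
    "\<And>v. v \<in> carrier_vec nd \<Longrightarrow> (?N *\<^sub>v v) \<bullet> (?N *\<^sub>v v) \<le> CQ * (v \<bullet> v)"
    using mult_mat_vec_bound[OF N(2)] by blast
  obtain CS where CS: "CS > 0"
    "\<And>v. v \<in> carrier_vec ne \<Longrightarrow> (St *\<^sub>v v) \<bullet> (St *\<^sub>v v) \<le> CS * (v \<bullet> v)"
    using mult_mat_vec_bound[OF Pt_blocks(2)] by blast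
  have BDt: "B\<^sup>T \<in> carrier_mat nd n" "D\<^sup>T \<in> carrier_mat nd ne"
    using B D by auto
  obtain CB where CB: "CB > 0"
    "\<And>v. v \<in> carrier_vec n \<Longrightarrow> (B\<^sup>T *\<^sub>v v) \<bullet> (B\<^sup>T *\<^sub>v v) \<le> CB * (v \<bullet> v)"
    using mult_mat_vec_bound[OF BDt(1)] by blast
  obtain CD where CD: "CD > 0"
    "\<And>v. v \<in> carrier_vec ne \<Longrightarrow> (D\<^sup>T *\<^sub>v v) \<bullet> (D\<^sup>T *\<^sub>v v) \<le> CD * (v \<bullet> v)"
    using mult_mat_vec_bound[OF BDt(2)] by blast
  \<comment> \<open>Splitting d, then its second summand, then q by |a + b|^2 <= 2 |a|^2 + 2 |b|^2
    leaves the coefficients 8 CQ CB for |\<xi>|^2 and 4 CS + 8 CQ CD for |\<eta>|^2. The number L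
    \<epsilon> dominates both, and 2 CN is the coefficient of the form of - Qt at u.\<close>
  define L where "L = (4 * CS + 8 * CQ * (CB + CD)) / \<epsilon>"
  define C where "C = 2 * CN + L"
  have L: "L > 0"
    unfolding L_def using CS CQ CB CD \<open>\<epsilon> > 0\<close> by (intro divide_pos_pos add_pos_pos mult_pos_pos) auto
  then have C: "C > 0" using CN by (simp add: C_def)
  show thesis
  proof (rule that[of "1 / C"])
    show "1 / C > 0" using C by simp
    fix x xp d e a \<xi> \<eta> q :: "real vec"
    assume x: "x \<in> carrier_vec n" and xp: "xp \<in> carrier_vec n" and d: "d \<in> carrier_vec nd"
      and e: "e \<in> carrier_vec ne" and a: "a \<in> carrier_vec n"
      and \<xi>_def: "\<xi> = X *\<^sub>v xp" and \<eta>_def: "\<eta> = Sp\<^sup>T *\<^sub>v d + Rp *\<^sub>v e"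
      and q_def: "q = B\<^sup>T *\<^sub>v \<xi> + D\<^sup>T *\<^sub>v \<eta>"
      and adj: "a \<bullet> x + q \<bullet> d = \<xi> \<bullet> xp + \<eta> \<bullet> e"
      and dual: "- quad_form Y \<xi> + quad_form Y a + quad_form Ptp (\<eta> @\<^sub>v q)
        \<le> - \<epsilon> * (\<xi> \<bullet> \<xi> + \<eta> \<bullet> \<eta>)"
    define t where "t = Qp *\<^sub>v d + Sp *\<^sub>v e"
    define u where "u = t + q"
    have cs: "\<xi> \<in> carrier_vec n" "\<eta> \<in> carrier_vec ne" "q \<in> carrier_vec nd" "t \<in> carrier_vec nd"
      "u \<in> carrier_vec nd"
      using XY_carrier Pp_blocks B D xp d e by (auto simp: \<xi>_def \<eta>_def q_def t_def u_def)
    have id: "quad_form X xp - quad_form X x + quad_form Pp (d @\<^sub>v e)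
        = - quad_form Y (a - X *\<^sub>v x) + quad_form Qt u
          + (quad_form Y a - quad_form Y \<xi> + quad_form Ptp (\<eta> @\<^sub>v q))"
      using dualization_identity[OF x xp d e a cs(3)] adj
      unfolding \<xi>_def \<eta>_def t_def u_def by blast
    have "quad_form Y (a - X *\<^sub>v x) \<ge> 0"
      using XY_carrier a x by (intro pos_semidef_quad_form[OF pos_def_imp_pos_semidef[OF Y_pos]]) auto
    moreover have Qu: "quad_form Qt u = - quad_form ?N u"
      using quad_form_uminus_mat[OF Pt_blocks(1) cs(5)] by simp
    moreover have "\<epsilon> * (\<xi> \<bullet> \<xi> + \<eta> \<bullet> \<eta>) = \<epsilon> * (\<xi> \<bullet> \<xi>) + \<epsilon> * (\<eta> \<bullet> \<eta>)"
      by (simp add: algebra_simps)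
    ultimately have le: "quad_form X xp - quad_form X x + quad_form Pp (d @\<^sub>v e)
        \<le> - (quad_form ?N u + \<epsilon> * (\<xi> \<bullet> \<xi> + \<eta> \<bullet> \<eta>))"
      using id dual by linarith
    have dsplit: "d = - (?N *\<^sub>v u) + (St *\<^sub>v \<eta> + ?N *\<^sub>v q)"
    proof -
      have "d = Qt *\<^sub>v t + St *\<^sub>v \<eta>"
        using inverse_index_vec(2)[OF d e] by (simp add: t_def \<eta>_def)
      moreover have "Qt *\<^sub>v u = Qt *\<^sub>v t + Qt *\<^sub>v q"
        unfolding u_def using Pt_blocks cs by (intro mult_add_distrib_mat_vec) auto
      ultimately show ?thesis
        using Pt_blocks cs by (intro eq_vecI) auto
    qed
    have c3: "?N *\<^sub>v u \<in> carrier_vec nd" "St *\<^sub>v \<eta> \<in> carrier_vec nd" "?N *\<^sub>v q \<in> carrier_vec nd"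
      "B\<^sup>T *\<^sub>v \<xi> \<in> carrier_vec nd" "D\<^sup>T *\<^sub>v \<eta> \<in> carrier_vec nd"
      using N Pt_blocks cs BDt by auto
    have "d \<bullet> d \<le> 2 * (- (?N *\<^sub>v u) \<bullet> - (?N *\<^sub>v u))
        + 2 * ((St *\<^sub>v \<eta> + ?N *\<^sub>v q) \<bullet> (St *\<^sub>v \<eta> + ?N *\<^sub>v q))"
      by (subst (1 2) dsplit, rule scalar_prod_add_self_le[of _ nd]) (use c3 in auto)
    moreover have "- (?N *\<^sub>v u) \<bullet> - (?N *\<^sub>v u) = (?N *\<^sub>v u) \<bullet> (?N *\<^sub>v u)"
      using c3 by simp
    moreover have "(St *\<^sub>v \<eta> + ?N *\<^sub>v q) \<bullet> (St *\<^sub>v \<eta> + ?N *\<^sub>v q)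
        \<le> 2 * ((St *\<^sub>v \<eta>) \<bullet> (St *\<^sub>v \<eta>)) + 2 * ((?N *\<^sub>v q) \<bullet> (?N *\<^sub>v q))"
      using c3 by (intro scalar_prod_add_self_le[of _ nd])
    moreover have "(?N *\<^sub>v u) \<bullet> (?N *\<^sub>v u) \<le> CN * quad_form ?N u"
      "(St *\<^sub>v \<eta>) \<bullet> (St *\<^sub>v \<eta>) \<le> CS * (\<eta> \<bullet> \<eta>)" "(?N *\<^sub>v q) \<bullet> (?N *\<^sub>v q) \<le> CQ * (q \<bullet> q)"
      using CN CS CQ cs by blast+
    moreover have "CQ * (q \<bullet> q) \<le> CQ * (2 * CB * (\<xi> \<bullet> \<xi>) + 2 * CD * (\<eta> \<bullet> \<eta>))"
    proof -
      have "q \<bullet> q \<le> 2 * ((B\<^sup>T *\<^sub>v \<xi>) \<bullet> (B\<^sup>T *\<^sub>v \<xi>)) + 2 * ((D\<^sup>T *\<^sub>v \<eta>) \<bullet> (D\<^sup>T *\<^sub>v \<eta>))"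
        unfolding q_def using c3 by (intro scalar_prod_add_self_le[of _ nd])
      also have "\<dots> \<le> 2 * CB * (\<xi> \<bullet> \<xi>) + 2 * CD * (\<eta> \<bullet> \<eta>)"
        using CB(2)[OF cs(1)] CD(2)[OF cs(2)] by simp
      finally show ?thesis using CQ by simp
    qed
    ultimately have "d \<bullet> d \<le> 2 * (CN * quad_form ?N u) + 4 * (CS * (\<eta> \<bullet> \<eta>))
        + 4 * (CQ * (2 * CB * (\<xi> \<bullet> \<xi>) + 2 * CD * (\<eta> \<bullet> \<eta>)))"
      by linarith
    also have "\<dots> \<le> C * quad_form ?N u + C * (\<epsilon> * (\<xi> \<bullet> \<xi> + \<eta> \<bullet> \<eta>))"
    proof -
      have nn: "quad_form ?N u \<ge> 0" "\<xi> \<bullet> \<xi> \<ge> 0" "\<eta> \<bullet> \<eta> \<ge> 0"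
        using pos_semidef_quad_form[OF N(1) cs(5)] scalar_prod_self_nonneg by auto
      \<comment> \<open>The nonnegative third group of terms fills both coefficients up to the
        common value L \<epsilon>.\<close>
      have "4 * (CS * (\<eta> \<bullet> \<eta>)) + 4 * (CQ * (2 * CB * (\<xi> \<bullet> \<xi>) + 2 * CD * (\<eta> \<bullet> \<eta>)))
          + (4 * (CS * (\<xi> \<bullet> \<xi>)) + 8 * (CQ * CD * (\<xi> \<bullet> \<xi>)) + 8 * (CQ * CB * (\<eta> \<bullet> \<eta>)))
          = L * \<epsilon> * (\<xi> \<bullet> \<xi> + \<eta> \<bullet> \<eta>)"
      proof -
        have "L * \<epsilon> = 4 * CS + 8 * CQ * (CB + CD)"
          using \<open>\<epsilon> > 0\<close> by (simp add: L_def)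
        then show ?thesis by (simp only:) (simp add: algebra_simps)
      qed
      moreover have "0 \<le> 4 * (CS * (\<xi> \<bullet> \<xi>)) + 8 * (CQ * CD * (\<xi> \<bullet> \<xi>)) + 8 * (CQ * CB * (\<eta> \<bullet> \<eta>))"
        using nn CS CQ CB CD by simp
      moreover have "C * quad_form ?N u + C * (\<epsilon> * (\<xi> \<bullet> \<xi> + \<eta> \<bullet> \<eta>))
          = 2 * (CN * quad_form ?N u) + L * quad_form ?N u
            + 2 * CN * (\<epsilon> * (\<xi> \<bullet> \<xi> + \<eta> \<bullet> \<eta>)) + L * \<epsilon> * (\<xi> \<bullet> \<xi> + \<eta> \<bullet> \<eta>)"
        by (simp add: C_def algebra_simps)
      moreover have "L * quad_form ?N u \<ge> 0" "2 * CN * (\<epsilon> * (\<xi> \<bullet> \<xi> + \<eta> \<bullet> \<eta>)) \<ge> 0"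
        using nn L CN \<open>\<epsilon> > 0\<close> by auto
      ultimately show ?thesis by linarith
    qed
    finally have "1 / C * (d \<bullet> d) \<le> quad_form ?N u + \<epsilon> * (\<xi> \<bullet> \<xi> + \<eta> \<bullet> \<eta>)"
      using C by (simp add: field_simps)
    then show "quad_form X xp - quad_form X x + quad_form Pp (d @\<^sub>v e) \<le> - (1 / C) * (d \<bullet> d)"
      using le by linarith
  qed
qed

lemma state_dissipation:
  assumes B: "B \<in> carrier_mat n nd" and "\<epsilon> > 0" "\<delta> > 0"
  obtains \<gamma> where "\<gamma> > 0"
    "\<And>x xp d a \<xi> q. \<lbrakk>x \<in> carrier_vec n; xp \<in> carrier_vec n; d \<in> carrier_vec nd;
      a \<in> carrier_vec n; \<xi> = X *\<^sub>v xp; q = B\<^sup>T *\<^sub>v \<xi>; a \<bullet> x + q \<bullet> d = \<xi> \<bullet> xp;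
      - quad_form Y \<xi> + (1 + \<delta>) * quad_form Y a + quad_form Ptp (0\<^sub>v ne @\<^sub>v q) \<le> - \<epsilon> * (\<xi> \<bullet> \<xi>)\<rbrakk>
      \<Longrightarrow> quad_form X xp \<le> quad_form X x / (1 + \<delta>) + \<gamma> * (d \<bullet> d)"
proof -
  obtain C where C: "C > 0"
    "\<And>v. v \<in> carrier_vec nd \<Longrightarrow> (B *\<^sub>v v) \<bullet> (B *\<^sub>v v) \<le> C * (v \<bullet> v)"
    using mult_mat_vec_bound[OF B] by blast
  show thesis
  proof (rule that[of "C / \<epsilon>"])
    show "C / \<epsilon> > 0" using C \<open>\<epsilon> > 0\<close> by simp
    fix x xp d a \<xi> q :: "real vec"
    assume x: "x \<in> carrier_vec n" and xp: "xp \<in> carrier_vec n" and d: "d \<in> carrier_vec nd"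
      and a: "a \<in> carrier_vec n"
      and \<xi>_def: "\<xi> = X *\<^sub>v xp" and q_def: "q = B\<^sup>T *\<^sub>v \<xi>"
      and adj: "a \<bullet> x + q \<bullet> d = \<xi> \<bullet> xp"
      and dual: "- quad_form Y \<xi> + (1 + \<delta>) * quad_form Y a + quad_form Ptp (0\<^sub>v ne @\<^sub>v q)
        \<le> - \<epsilon> * (\<xi> \<bullet> \<xi>)"
    have \<xi>: "\<xi> \<in> carrier_vec n" and q: "q \<in> carrier_vec nd" and Bd: "B *\<^sub>v d \<in> carrier_vec n"
      and Xx: "X *\<^sub>v x \<in> carrier_vec n"
      using XY_carrier xp B x d by (auto simp: \<xi>_def q_def)
    have "St *\<^sub>v 0\<^sub>v ne = 0\<^sub>v nd"
      using Pt_blocks by auto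
    then have "quad_form Ptp (0\<^sub>v ne @\<^sub>v q) = - quad_form Qt q"
      using Ptp_quad_form[of "0\<^sub>v ne" q] q Pt_blocks
      by (simp add: quad_form_def)
    then have P: "quad_form Ptp (0\<^sub>v ne @\<^sub>v q) \<ge> 0"
      using neg_semidef_quad_form[OF Qt_neg q] by simp
    have xixp: "\<xi> \<bullet> xp = quad_form X xp" "quad_form Y \<xi> = quad_form X xp"
      using XY_carrier xp quad_form_Y_X[OF xp] by (simp_all add: \<xi>_def quad_form_def comm_scalar_prod[of _ n])
    \<comment> \<open>Young's inequality for a . x in the metric of \<open>Y\<close>. Dividing by 1
      + \<delta> produces the contraction factor.\<close>
    have "0 \<le> quad_form Y ((1 + \<delta>) \<cdot>\<^sub>v a - X *\<^sub>v x)"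
      using XY_carrier a x by (intro pos_semidef_quad_form[OF pos_def_imp_pos_semidef[OF Y_pos]]) auto
    also have "\<dots> = (1 + \<delta>)\<^sup>2 * quad_form Y a - 2 * (1 + \<delta>) * (a \<bullet> x) + quad_form X x"
      using quad_form_minus[OF XY_carrier(4) _ Xx, of "(1 + \<delta>) \<cdot>\<^sub>v a"] a x
        quad_form_smult[OF XY_carrier(2) a] YX_cancel[OF x] quad_form_Y_X[OF x] by simp
    finally have "(1 + \<delta>) * (2 * (a \<bullet> x)) \<le> (1 + \<delta>) * ((1 + \<delta>) * quad_form Y a) + quad_form X x"
      by (simp add: power2_eq_square algebra_simps)
    then have ax: "2 * (a \<bullet> x) \<le> (1 + \<delta>) * quad_form Y a + quad_form X x / (1 + \<delta>)"
      using \<open>\<delta> > 0\<close> by (simp add: field_simps)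
    have qd: "q \<bullet> d = \<xi> \<bullet> (B *\<^sub>v d)"
      unfolding q_def by (rule transpose_vec_mult_scalar[OF B d \<xi>])
    have I: "sym_mat n (1\<^sub>m n)" by (simp add: sym_mat_def)
    \<comment> \<open>Young's inequality for \<xi> . B d, weighted so that |\<xi>|^2 gets exactly
      the available coefficient \<epsilon>.\<close>
    have "0 \<le> quad_form (1\<^sub>m n) (\<epsilon> \<cdot>\<^sub>v \<xi> - B *\<^sub>v d)"
      using \<xi> Bd scalar_prod_self_nonneg by (simp add: quad_form_one[of _ n])
    also have "\<dots> = \<epsilon>\<^sup>2 * (\<xi> \<bullet> \<xi>) - 2 * \<epsilon> * (\<xi> \<bullet> (B *\<^sub>v d)) + (B *\<^sub>v d) \<bullet> (B *\<^sub>v d)"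
      using quad_form_minus[OF I _ Bd, of "\<epsilon> \<cdot>\<^sub>v \<xi>"] \<xi> Bd
      by (simp add: quad_form_one[of _ n] power2_eq_square)
    finally have "\<epsilon> * (2 * (\<xi> \<bullet> (B *\<^sub>v d))) \<le> \<epsilon> * (\<epsilon> * (\<xi> \<bullet> \<xi>)) + C * (d \<bullet> d)"
      using C(2)[OF d] by (simp add: power2_eq_square algebra_simps)
    then have "2 * (q \<bullet> d) \<le> \<epsilon> * (\<xi> \<bullet> \<xi>) + C / \<epsilon> * (d \<bullet> d)"
      using \<open>\<epsilon> > 0\<close> unfolding qd by (simp add: field_simps)
    then show "quad_form X xp \<le> quad_form X x / (1 + \<delta>) + C / \<epsilon> * (d \<bullet> d)"
      using ax adj dual P xixp by linarith
  qed
qed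

end

section \<open>The synthesis inequality\<close>

lemma append_vec_assoc: "(u @\<^sub>v v) @\<^sub>v w = u @\<^sub>v v @\<^sub>v w"
  by (intro eq_vecI) auto

lemma append_cols_carrier [simp, intro]:
  "A \<in> carrier_mat r p \<Longrightarrow> B \<in> carrier_mat r q \<Longrightarrow> A @\<^sub>c B \<in> carrier_mat r (p + q)"
  by (auto simp: append_cols_def)

lemma append_cols_mult_vec:
  fixes A :: "real mat"
  assumes "A \<in> carrier_mat r p" "B \<in> carrier_mat r q" "u \<in> carrier_vec p" "v \<in> carrier_vec q"
  shows "(A @\<^sub>c B) *\<^sub>v (u @\<^sub>v v) = A *\<^sub>v u + B *\<^sub>v v"
proof -
  have "(A @\<^sub>c B) *\<^sub>v (u @\<^sub>v v) = (A *\<^sub>v u + B *\<^sub>v v) @\<^sub>v (0\<^sub>m 0 p *\<^sub>v u + 0\<^sub>m 0 q *\<^sub>v v)"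
    unfolding append_cols_def using assms
    by (subst four_block_mat_mult_vec[of _ r p _ q _ 0]) auto
  also have "\<dots> = A *\<^sub>v u + B *\<^sub>v v"
    using assms by (intro eq_vecI) auto
  finally show ?thesis .
qed

lemma zero_mat_mult_vec: "v \<in> carrier_vec q \<Longrightarrow> 0\<^sub>m p q *\<^sub>v v = (0\<^sub>v p :: real vec)"
  by auto

lemma quad_form_diag_block_Cons:
  assumes "A \<in> carrier_mat p p" "diag_block_mat As \<in> carrier_mat q q"
    and "u \<in> carrier_vec p" "v \<in> carrier_vec q"
  shows "quad_form (diag_block_mat (A # As)) (u @\<^sub>v v)
    = quad_form A u + quad_form (diag_block_mat As) v"
  using assms quad_form_append_diag[OF assms] by (simp add: Let_def)

lemma diag_block_Cons_carrier:
  assumes "A \<in> carrier_mat p p" "diag_block_mat As \<in> carrier_mat q q"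
  shows "diag_block_mat (A # As) \<in> carrier_mat (p + q) (p + q)"
  using assms by (auto simp: Let_def)

text \<open>The eight block rows are regrouped into five vectors, one for each of the diagonal
  blocks \<open>- Y\<close>, \<open>Y\<close>, \<open>P'\<close>, \<open>Pcom\<close>,
  \<open>Ptp\<close>. The row dimension is bracketed in the same way.\<close>

lemma outer_factor_mult_vec:
  assumes dims: "plant_dims G n m nd ne nw nz nw' nz'" and K: "K \<in> carrier_mat m n"
    and v: "\<xi> \<in> carrier_vec n" "p' \<in> carrier_vec nz'" "p \<in> carrier_vec nz" "\<eta> \<in> carrier_vec ne"
  shows "outer_factor G K n nd ne nz nw' nz' *\<^sub>v (\<xi> @\<^sub>v p' @\<^sub>v p @\<^sub>v \<eta>) =
    \<xi> @\<^sub>v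
    ((pA G + pB G * K)\<^sup>T *\<^sub>v \<xi> + ((pCz' G + pDz' G * K)\<^sup>T *\<^sub>v p' + ((pCz G + pDz G * K)\<^sup>T *\<^sub>v p
      + (pCe G + pDeu G * K)\<^sup>T *\<^sub>v \<eta>))) @\<^sub>v
    (p' @\<^sub>v ((pBw' G)\<^sup>T *\<^sub>v \<xi> + (pDzw' G)\<^sup>T *\<^sub>v p)) @\<^sub>v
    (p @\<^sub>v \<xi>) @\<^sub>v
    (\<eta> @\<^sub>v ((pBd G)\<^sup>T *\<^sub>v \<xi> + (pDed G)\<^sup>T *\<^sub>v \<eta>))"
    (is "_ = ?rhs")
    and "outer_factor G K n nd ne nz nw' nz' \<in>
      carrier_mat (n + (n + ((nz' + nw') + ((nz + n) + (ne + nd))))) (n + (nz' + (nz + ne)))"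
proof -
  have c: "pA G + pB G * K \<in> carrier_mat n n" "pCz' G + pDz' G * K \<in> carrier_mat nz' n"
    "pCz G + pDz G * K \<in> carrier_mat nz n" "pCe G + pDeu G * K \<in> carrier_mat ne n"
    "pBw' G \<in> carrier_mat n nw'" "pDzw' G \<in> carrier_mat nz nw'"
    "pBd G \<in> carrier_mat n nd" "pDed G \<in> carrier_mat ne nd"
    using dims K unfolding plant_dims_def by (blast intro: add_carrier_mat mult_carrier_mat)+
  define AK where "AK = pA G + pB G * K"
  define CK' where "CK' = pCz' G + pDz' G * K"
  define CK where "CK = pCz G + pDz G * K"
  define EK where "EK = pCe G + pDeu G * K"
  note defs = AK_def[symmetric] CK'_def[symmetric] CK_def[symmetric] EK_def[symmetric]
  have ct: "AK\<^sup>T \<in> carrier_mat n n" "CK'\<^sup>T \<in> carrier_mat n nz'" "CK\<^sup>T \<in> carrier_mat n nz"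
    "EK\<^sup>T \<in> carrier_mat n ne" "(pBw' G)\<^sup>T \<in> carrier_mat nw' n" "(pDzw' G)\<^sup>T \<in> carrier_mat nw' nz"
    "(pBd G)\<^sup>T \<in> carrier_mat nd n" "(pDed G)\<^sup>T \<in> carrier_mat nd ne"
    using c unfolding defs by auto
  let ?c = "n + (nz' + (nz + ne))"
  let ?r1 = "1\<^sub>m n @\<^sub>c 0\<^sub>m n nz' @\<^sub>c 0\<^sub>m n nz @\<^sub>c 0\<^sub>m n ne :: real mat"
  let ?r2 = "AK\<^sup>T @\<^sub>c CK'\<^sup>T @\<^sub>c CK\<^sup>T @\<^sub>c EK\<^sup>T"
  let ?r3 = "0\<^sub>m nz' n @\<^sub>c 1\<^sub>m nz' @\<^sub>c 0\<^sub>m nz' nz @\<^sub>c 0\<^sub>m nz' ne :: real mat"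
  let ?r4 = "(pBw' G)\<^sup>T @\<^sub>c 0\<^sub>m nw' nz' @\<^sub>c (pDzw' G)\<^sup>T @\<^sub>c 0\<^sub>m nw' ne"
  let ?r5 = "0\<^sub>m nz n @\<^sub>c 0\<^sub>m nz nz' @\<^sub>c 1\<^sub>m nz @\<^sub>c 0\<^sub>m nz ne :: real mat"
  let ?r7 = "0\<^sub>m ne n @\<^sub>c 0\<^sub>m ne nz' @\<^sub>c 0\<^sub>m ne nz @\<^sub>c 1\<^sub>m ne :: real mat"
  let ?r8 = "(pBd G)\<^sup>T @\<^sub>c 0\<^sub>m nd nz' @\<^sub>c 0\<^sub>m nd nz @\<^sub>c (pDed G)\<^sup>T"
  have r: "?r1 \<in> carrier_mat n ?c" "?r2 \<in> carrier_mat n ?c" "?r3 \<in> carrier_mat nz' ?c"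
    "?r4 \<in> carrier_mat nw' ?c" "?r5 \<in> carrier_mat nz ?c" "?r7 \<in> carrier_mat ne ?c"
    "?r8 \<in> carrier_mat nd ?c"
    by (intro append_cols_carrier ct one_carrier_mat zero_carrier_mat)+
  let ?v = "\<xi> @\<^sub>v p' @\<^sub>v p @\<^sub>v \<eta>"
  have cv: "?v \<in> carrier_vec ?c" "p' @\<^sub>v p @\<^sub>v \<eta> \<in> carrier_vec (nz' + (nz + ne))"
    "p @\<^sub>v \<eta> \<in> carrier_vec (nz + ne)"
    using v by auto
  have row: "(A @\<^sub>c B @\<^sub>c C @\<^sub>c D) *\<^sub>v ?v = A *\<^sub>v \<xi> + (B *\<^sub>v p' + (C *\<^sub>v p + D *\<^sub>v \<eta>))"
    if "A \<in> carrier_mat s n" "B \<in> carrier_mat s nz'" "C \<in> carrier_mat s nz" "D \<in> carrier_mat s ne"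
    for A B C D :: "real mat" and s
    using that v cv
    by (simp add: append_cols_mult_vec[of A s n _ "nz' + (nz + ne)"]
        append_cols_mult_vec[of B s nz' _ "nz + ne"] append_cols_mult_vec[of C s nz _ ne])
  have F: "outer_factor G K n nd ne nz nw' nz' =
      ?r1 @\<^sub>r ?r2 @\<^sub>r ?r3 @\<^sub>r ?r4 @\<^sub>r ?r5 @\<^sub>r ?r1 @\<^sub>r ?r7 @\<^sub>r ?r8"
    by (simp add: outer_factor_def defs)
  \<comment> \<open>Dimensions of the trailing stacks of rows, built from the bottom upwards. The
    sixth block row repeats the first, so \<open>r(1)\<close> serves for it as well.\<close>
  note q7 = carrier_append_rows[OF r(6,7)]
  note q6 = carrier_append_rows[OF r(1) q7]
  note q5 = carrier_append_rows[OF r(5) q6]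
  note q4 = carrier_append_rows[OF r(4) q5]
  note q3 = carrier_append_rows[OF r(3) q4]
  note q2 = carrier_append_rows[OF r(2) q3]
  have "outer_factor G K n nd ne nz nw' nz' \<in>
      carrier_mat (n + (n + (nz' + (nw' + (nz + (n + (ne + nd))))))) ?c"
    unfolding F by (rule carrier_append_rows[OF r(1) q2])
  then show "outer_factor G K n nd ne nz nw' nz' \<in>
      carrier_mat (n + (n + ((nz' + nw') + ((nz + n) + (ne + nd))))) ?c"
    by (simp add: add.assoc)
  have "outer_factor G K n nd ne nz nw' nz' *\<^sub>v ?v =
      (?r1 *\<^sub>v ?v) @\<^sub>v (?r2 *\<^sub>v ?v) @\<^sub>v (?r3 *\<^sub>v ?v) @\<^sub>v (?r4 *\<^sub>v ?v) @\<^sub>v (?r5 *\<^sub>v ?v) @\<^sub>v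
      (?r1 *\<^sub>v ?v) @\<^sub>v (?r7 *\<^sub>v ?v) @\<^sub>v (?r8 *\<^sub>v ?v)"
    by (simp only: F mat_mult_append[OF r(1) q2 cv(1)] mat_mult_append[OF r(2) q3 cv(1)]
        mat_mult_append[OF r(3) q4 cv(1)] mat_mult_append[OF r(4) q5 cv(1)]
        mat_mult_append[OF r(5) q6 cv(1)] mat_mult_append[OF r(1) q7 cv(1)]
        mat_mult_append[OF r(6,7) cv(1)])
  moreover have "?r1 *\<^sub>v ?v = \<xi>" "?r3 *\<^sub>v ?v = p'" "?r5 *\<^sub>v ?v = p" "?r7 *\<^sub>v ?v = \<eta>"
    using v by (simp_all add: row[where s = n] row[where s = nz'] row[where s = nz]
        row[where s = ne] zero_mat_mult_vec)
  moreover have "?r4 *\<^sub>v ?v = (pBw' G)\<^sup>T *\<^sub>v \<xi> + (pDzw' G)\<^sup>T *\<^sub>v p"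
    "?r8 *\<^sub>v ?v = (pBd G)\<^sup>T *\<^sub>v \<xi> + (pDed G)\<^sup>T *\<^sub>v \<eta>"
    using v ct by (simp_all add: row[where s = nw'] row[where s = nd] zero_mat_mult_vec)
  moreover have "?r2 *\<^sub>v ?v = AK\<^sup>T *\<^sub>v \<xi> + (CK'\<^sup>T *\<^sub>v p' + (CK\<^sup>T *\<^sub>v p + EK\<^sup>T *\<^sub>v \<eta>))"
    by (rule row[OF ct(1-4)])
  ultimately show "outer_factor G K n nd ne nz nw' nz' *\<^sub>v ?v = ?rhs"
    unfolding defs by (simp add: append_vec_assoc)
qed

text \<open>Strictness yields a slack c |v|^2 in the stacked vector v. One half is kept as the
  margin in \<xi> and \<eta>. The other half pays for the extra \<delta> (a . Y a), which is
  possible because a depends linearly on v. The factor 1 + \<delta> later becomes the decay rate of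
  the storage function.\<close>

lemma synthesis_LMI_margin:
  assumes dims: "plant_dims G n m nd ne nw nz nw' nz'" and K: "K \<in> carrier_mat m n"
    and Y: "Y \<in> carrier_mat n n" and P': "P' \<in> carrier_mat (nz' + nw') (nz' + nw')"
    and Pcom: "Pcom \<in> carrier_mat (nz + n) (nz + n)"
    and Ptp: "Ptp \<in> carrier_mat (ne + nd) (ne + nd)"
    and F_def: "F = outer_factor G K n nd ne nz nw' nz'"
    and LMI: "neg_def (n + nz' + nz + ne) (F\<^sup>T * diag_block_mat [- Y, Y, P', Pcom, Ptp] * F)"
  obtains \<epsilon> \<delta> where "\<epsilon> > 0" "\<delta> > 0"
    "\<And>\<xi> p' p \<eta> a. \<lbrakk>\<xi> \<in> carrier_vec n; p' \<in> carrier_vec nz'; p \<in> carrier_vec nz; \<eta> \<in> carrier_vec ne;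
      a = (pA G + pB G * K)\<^sup>T *\<^sub>v \<xi> + ((pCz' G + pDz' G * K)\<^sup>T *\<^sub>v p' + ((pCz G + pDz G * K)\<^sup>T *\<^sub>v p
        + (pCe G + pDeu G * K)\<^sup>T *\<^sub>v \<eta>))\<rbrakk> \<Longrightarrow>
      - quad_form Y \<xi> + (1 + \<delta>) * quad_form Y a
        + quad_form P' (p' @\<^sub>v ((pBw' G)\<^sup>T *\<^sub>v \<xi> + (pDzw' G)\<^sup>T *\<^sub>v p)) + quad_form Pcom (p @\<^sub>v \<xi>)
        + quad_form Ptp (\<eta> @\<^sub>v ((pBd G)\<^sup>T *\<^sub>v \<xi> + (pDed G)\<^sup>T *\<^sub>v \<eta>)) \<le> - \<epsilon> * (\<xi> \<bullet> \<xi> + \<eta> \<bullet> \<eta>)"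
proof -
  define AK where "AK = pA G + pB G * K"
  define CK' where "CK' = pCz' G + pDz' G * K"
  define CK where "CK = pCz G + pDz G * K"
  define EK where "EK = pCe G + pDeu G * K"
  note defs = AK_def[symmetric] CK'_def[symmetric] CK_def[symmetric] EK_def[symmetric]
  have "AK \<in> carrier_mat n n" "CK' \<in> carrier_mat nz' n" "CK \<in> carrier_mat nz n"
    "EK \<in> carrier_mat ne n" and G: "pBw' G \<in> carrier_mat n nw'" "pDzw' G \<in> carrier_mat nz nw'"
    "pBd G \<in> carrier_mat n nd" "pDed G \<in> carrier_mat ne nd"
    using dims K unfolding plant_dims_def AK_def CK'_def CK_def EK_def
    by (blast intro: add_carrier_mat mult_carrier_mat)+
  then have ct: "AK\<^sup>T \<in> carrier_mat n n" "CK'\<^sup>T \<in> carrier_mat n nz'" "CK\<^sup>T \<in> carrier_mat n nz"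
    "EK\<^sup>T \<in> carrier_mat n ne"
    by auto
  let ?c = "n + (nz' + (nz + ne))"
  let ?k = "n + (n + ((nz' + nw') + ((nz + n) + (ne + nd))))"
  let ?r2 = "AK\<^sup>T @\<^sub>c CK'\<^sup>T @\<^sub>c CK\<^sup>T @\<^sub>c EK\<^sup>T"
  let ?D = "diag_block_mat [- Y, Y, P', Pcom, Ptp]"
  have r2: "?r2 \<in> carrier_mat n ?c"
    by (intro append_cols_carrier ct)
  have F: "F \<in> carrier_mat ?k ?c"
    unfolding F_def by (rule outer_factor_mult_vec(2)[OF dims K]; rule zero_carrier_vec)
  have d1: "diag_block_mat [Ptp] \<in> carrier_mat (ne + nd) (ne + nd)"
    using Ptp by (simp del: diag_block_mat.simps)
  note d2 = diag_block_Cons_carrier[OF Pcom d1]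
  note d3 = diag_block_Cons_carrier[OF P' d2]
  note d4 = diag_block_Cons_carrier[OF Y d3]
  have Y': "- Y \<in> carrier_mat n n" using Y by simp
  note d5 = diag_block_Cons_carrier[OF Y' d4]
  let ?H = "F\<^sup>T * ?D * F"
  have H: "?H \<in> carrier_mat ?c ?c"
    using F d5 by (auto simp del: diag_block_mat.simps)
  have "pos_def ?c (- ?H)"
    using LMI by (simp add: neg_def_def add.assoc)
  then obtain c where c: "c > 0" "\<And>v. v \<in> carrier_vec ?c \<Longrightarrow> c * (v \<bullet> v) \<le> quad_form (- ?H) v"
    using pos_def_lower_bound by blast
  obtain CY where CY: "CY > 0" "\<And>v. v \<in> carrier_vec n \<Longrightarrow> \<bar>quad_form Y v\<bar> \<le> CY * (v \<bullet> v)"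
    using quad_form_bound[OF Y] by blast
  obtain C where C: "C > 0" "\<And>v. v \<in> carrier_vec ?c \<Longrightarrow> (?r2 *\<^sub>v v) \<bullet> (?r2 *\<^sub>v v) \<le> C * (v \<bullet> v)"
    using mult_mat_vec_bound[OF r2] by blast
  \<comment> \<open>Chosen so that \<delta> CY C = c / 2, where CY C bounds a . Y a relative to
    |v|^2.\<close>
  define \<delta> where "\<delta> = c / (2 * CY * C)"
  show thesis
  proof (rule that[of "c / 2" \<delta>])
    show "c / 2 > 0" "\<delta> > 0"
      using c CY C by (auto simp: \<delta>_def)
    fix \<xi> p' p \<eta> a :: "real vec"
    assume v: "\<xi> \<in> carrier_vec n" "p' \<in> carrier_vec nz'" "p \<in> carrier_vec nz" "\<eta> \<in> carrier_vec ne"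
      and a_def: "a = (pA G + pB G * K)\<^sup>T *\<^sub>v \<xi> + ((pCz' G + pDz' G * K)\<^sup>T *\<^sub>v p'
        + ((pCz G + pDz G * K)\<^sup>T *\<^sub>v p + (pCe G + pDeu G * K)\<^sup>T *\<^sub>v \<eta>))"
    let ?v = "\<xi> @\<^sub>v p' @\<^sub>v p @\<^sub>v \<eta>"
    let ?s = "p' @\<^sub>v ((pBw' G)\<^sup>T *\<^sub>v \<xi> + (pDzw' G)\<^sup>T *\<^sub>v p)"
    let ?t = "\<eta> @\<^sub>v ((pBd G)\<^sup>T *\<^sub>v \<xi> + (pDed G)\<^sup>T *\<^sub>v \<eta>)"
    have cv: "?v \<in> carrier_vec ?c" "p' @\<^sub>v p @\<^sub>v \<eta> \<in> carrier_vec (nz' + (nz + ne))"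
      "p @\<^sub>v \<eta> \<in> carrier_vec (nz + ne)"
      using v by auto
    have a: "a \<in> carrier_vec n"
      unfolding a_def defs using ct v by auto
    have s: "?s \<in> carrier_vec (nz' + nw')" and t: "?t \<in> carrier_vec (ne + nd)"
      and pxi: "p @\<^sub>v \<xi> \<in> carrier_vec (nz + n)"
      using G v by auto
    have a_r2: "?r2 *\<^sub>v ?v = a"
      unfolding a_def defs using v cv ct append_cols_carrier
      by (simp add: append_cols_mult_vec[of _ n n _ "nz' + (nz + ne)"]
        append_cols_mult_vec[of _ n nz' _ "nz + ne"] append_cols_mult_vec[of _ n nz _ ne])
    have Fv: "F *\<^sub>v ?v = \<xi> @\<^sub>v a @\<^sub>v ?s @\<^sub>v (p @\<^sub>v \<xi>) @\<^sub>v ?t"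
      unfolding F_def a_def by (rule outer_factor_mult_vec(1)[OF dims K v])
    have c1: "(p @\<^sub>v \<xi>) @\<^sub>v ?t \<in> carrier_vec ((nz + n) + (ne + nd))"
      by (intro append_carrier_vec pxi t)
    have c2: "?s @\<^sub>v (p @\<^sub>v \<xi>) @\<^sub>v ?t \<in> carrier_vec ((nz' + nw') + ((nz + n) + (ne + nd)))"
      by (intro append_carrier_vec s c1)
    have c3: "a @\<^sub>v ?s @\<^sub>v (p @\<^sub>v \<xi>) @\<^sub>v ?t \<in> carrier_vec (n + ((nz' + nw') + ((nz + n) + (ne + nd))))"
      by (intro append_carrier_vec a c2)
    have "quad_form ?H ?v = quad_form ?D (F *\<^sub>v ?v)"
      by (rule quad_form_congruence[OF d5 F cv(1)])
    also have "\<dots> = quad_form (- Y) \<xi> + (quad_form Y a + (quad_form P' ?s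
        + (quad_form Pcom (p @\<^sub>v \<xi>) + quad_form (diag_block_mat [Ptp]) ?t)))"
      unfolding Fv
      by (simp only: quad_form_diag_block_Cons[OF Y' d4 v(1) c3] quad_form_diag_block_Cons[OF Y d3 a c2]
          quad_form_diag_block_Cons[OF P' d2 s c1] quad_form_diag_block_Cons[OF Pcom d1 pxi t])
    also have "quad_form (- Y) \<xi> = - quad_form Y \<xi>"
      by (rule quad_form_uminus_mat[OF Y v(1)])
    also have "diag_block_mat [Ptp] = Ptp"
      by (rule diag_block_mat_singleton)
    finally have Hv: "quad_form ?H ?v = - quad_form Y \<xi> + (quad_form Y a + (quad_form P' ?s
        + (quad_form Pcom (p @\<^sub>v \<xi>) + quad_form Ptp ?t)))" .
    have "c * (?v \<bullet> ?v) \<le> - quad_form ?H ?v"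
      using c(2)[OF cv(1)] quad_form_uminus_mat[OF H cv(1)] by simp
    moreover have "\<delta> * quad_form Y a \<le> c / 2 * (?v \<bullet> ?v)"
    proof -
      have "quad_form Y a \<le> CY * (a \<bullet> a)"
        using CY(2)[OF a] by linarith
      also have "\<dots> \<le> CY * (C * (?v \<bullet> ?v))"
        using C(2)[OF cv(1)] CY unfolding a_r2 by simp
      finally have "\<delta> * quad_form Y a \<le> \<delta> * (CY * (C * (?v \<bullet> ?v)))"
        using \<open>\<delta> > 0\<close> by simp
      also have "\<dots> = c / 2 * (?v \<bullet> ?v)"
        using CY C by (simp add: \<delta>_def)
      finally show ?thesis .
    qed
    moreover have "c / 2 * (\<xi> \<bullet> \<xi> + \<eta> \<bullet> \<eta>) \<le> c / 2 * (?v \<bullet> ?v)"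
    proof (rule mult_left_mono)
      have "?v \<bullet> ?v = \<xi> \<bullet> \<xi> + (p' \<bullet> p' + (p \<bullet> p + \<eta> \<bullet> \<eta>))"
        using scalar_prod_append[OF v(1) cv(2) v(1) cv(2)] scalar_prod_append[OF v(2) cv(3) v(2) cv(3)]
          scalar_prod_append[OF v(3,4) v(3,4)] by simp
      then show "\<xi> \<bullet> \<xi> + \<eta> \<bullet> \<eta> \<le> ?v \<bullet> ?v"
        using scalar_prod_self_nonneg[of p] scalar_prod_self_nonneg[of p'] by simp
    qed (use c in simp)
    moreover have "(1 + \<delta>) * quad_form Y a = quad_form Y a + \<delta> * quad_form Y a"
      by (simp add: distrib_right)
    ultimately show "- quad_form Y \<xi> + (1 + \<delta>) * quad_form Y a + quad_form P' ?s
        + quad_form Pcom (p @\<^sub>v \<xi>) + quad_form Ptp ?t \<le> - (c / 2) * (\<xi> \<bullet> \<xi> + \<eta> \<bullet> \<eta>)"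
      using Hv by linarith
  qed
qed

section \<open>Multipliers\<close>

lemma append_rows_mult:
  fixes A :: "real mat"
  assumes "A \<in> carrier_mat r p" "B \<in> carrier_mat s p" "C \<in> carrier_mat p q"
  shows "(A @\<^sub>r B) * C = (A * C) @\<^sub>r (B * C)"
proof (rule eq_matI)
  show "dim_row ((A @\<^sub>r B) * C) = dim_row ((A * C) @\<^sub>r (B * C))"
    "dim_col ((A @\<^sub>r B) * C) = dim_col ((A * C) @\<^sub>r (B * C))"
    using assms by (auto simp: append_rows_def)
  fix i j assume "i < dim_row ((A * C) @\<^sub>r (B * C))" "j < dim_col ((A * C) @\<^sub>r (B * C))"
  then have i: "i < r + s" and j: "j < q"
    using assms by (auto simp: append_rows_def)
  have "row (A @\<^sub>r B) i = (if i < r then row A i else row B (i - r))"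
    using assms i by (intro eq_vecI) (auto simp: append_rows_def)
  then show "((A @\<^sub>r B) * C) $$ (i, j) = ((A * C) @\<^sub>r (B * C)) $$ (i, j)"
    using assms i j by (auto simp: append_rows_def)
qed

section \<open>Block columns of the identity and block-diagonal matrices\<close>

lemma id_block_col_carrier [simp]: "id_block_col l d j \<in> carrier_mat (\<Sum>i<l. d i) (d j)"
  by (simp add: id_block_col_def)

text \<open>Together with \<open>id_block_col_last\<close> this follows the recursion that splits
  off the last diagonal block, so identities for block columns can be proved by induction on the
  number of blocks.\<close>

lemma id_block_col_Suc:
  assumes "j < l"
  shows "id_block_col (Suc l) d j = id_block_col l d j @\<^sub>r 0\<^sub>m (d l) (d j)"
proof -
  \<comment> \<open>The ones of block column j lie within the first l block rows, so the appended
    rows contain only zeros.\<close>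
  have le: "(\<Sum>i<j. d i) + d j \<le> (\<Sum>i<l. d i)"
    using assms sum_mono2[of "{..<l}" "{..<Suc j}" d] by simp
  show ?thesis
    by (rule eq_matI) (use le in \<open>auto simp: id_block_col_def append_rows_def\<close>)
qed

lemma id_block_col_last: "id_block_col (Suc l) d l = 0\<^sub>m (\<Sum>i<l. d i) (d l) @\<^sub>r 1\<^sub>m (d l)"
  by (rule eq_matI) (auto simp: id_block_col_def append_rows_def)

lemma diag_mult_append_rows:
  fixes A :: "real mat"
  assumes "A \<in> carrier_mat r1 c1" "D \<in> carrier_mat r2 c2"
    and "U \<in> carrier_mat c1 q" "V \<in> carrier_mat c2 q"
  shows "four_block_mat A (0\<^sub>m r1 c2) (0\<^sub>m r2 c1) D * (U @\<^sub>r V) = (A * U) @\<^sub>r (D * V)"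
proof -
  \<comment> \<open>Stacking is read as a block matrix whose right blocks have width zero, so that
    block multiplication applies.\<close>
  have UV: "U @\<^sub>r V = four_block_mat U (0\<^sub>m c1 0) V (0\<^sub>m c2 0)"
    using assms by (simp add: append_rows_def)
  have z: "A * 0\<^sub>m c1 0 + 0\<^sub>m r1 c2 * 0\<^sub>m c2 0 = 0\<^sub>m r1 0" "0\<^sub>m r2 c1 * 0\<^sub>m c1 0 + D * 0\<^sub>m c2 0 = 0\<^sub>m r2 0"
    "A * U + 0\<^sub>m r1 c2 * V = A * U" "0\<^sub>m r2 c1 * U + D * V = D * V"
    using assms by auto
  show ?thesis
    unfolding UV by (subst mult_four_block_mat[of _ r1 c1 _ c2 _ r2 _ _ q _ 0])
      (use assms z in \<open>simp_all add: append_rows_def\<close>)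
qed

lemma diag_block_mat_upt_carrier:
  assumes "\<And>j. j < l \<Longrightarrow> D j \<in> carrier_mat (r j) (c j)"
  shows "diag_block_mat (map D [0..<l]) \<in> carrier_mat (\<Sum>i<l. r i) (\<Sum>i<l. c i)"
  using assms
proof (induction l)
  case (Suc l)
  then have "diag_block_mat (map D [0..<l]) \<in> carrier_mat (\<Sum>i<l. r i) (\<Sum>i<l. c i)"
    "D l \<in> carrier_mat (r l) (c l)"
    by auto
  then show ?case
    by (auto simp: diag_block_mat_last Let_def)
qed simp

text \<open>A block-diagonal \<Delta> intertwines the two families of block columns: \<Delta> L_j =
  R_j D_j. Transposed, this reduces the j-th multiplier term to the j-th uncertainty block
  alone.\<close>

lemma diag_block_mat_id_block_col:
  assumes "\<And>j. j < l \<Longrightarrow> D j \<in> carrier_mat (r j) (c j)" and "j < l"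
  shows "diag_block_mat (map D [0..<l]) * id_block_col l c j = id_block_col l r j * D j"
  using assms
proof (induction l arbitrary: j)
  case (Suc l)
  let ?B = "diag_block_mat (map D [0..<l])"
  have D: "\<And>j. j < l \<Longrightarrow> D j \<in> carrier_mat (r j) (c j)" "D l \<in> carrier_mat (r l) (c l)"
    "D j \<in> carrier_mat (r j) (c j)"
    using Suc.prems by auto
  have B: "?B \<in> carrier_mat (\<Sum>i<l. r i) (\<Sum>i<l. c i)"
    by (rule diag_block_mat_upt_carrier[OF D(1)])
  have BS: "diag_block_mat (map D [0..<Suc l]) =
      four_block_mat ?B (0\<^sub>m (\<Sum>i<l. r i) (c l)) (0\<^sub>m (r l) (\<Sum>i<l. c i)) (D l)"
    using B D by (auto simp: diag_block_mat_last Let_def)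
  show ?case
  proof (cases "j < l")
    case True
    have "diag_block_mat (map D [0..<Suc l]) * id_block_col (Suc l) c j
        = (?B * id_block_col l c j) @\<^sub>r (D l * 0\<^sub>m (c l) (c j))"
      unfolding BS id_block_col_Suc[OF True]
      by (rule diag_mult_append_rows[OF B D(2)]) auto
    also have "\<dots> = (id_block_col l r j * D j) @\<^sub>r (0\<^sub>m (r l) (r j) * D j)"
      using Suc.IH[OF D(1) True] D by simp
    also have "\<dots> = id_block_col (Suc l) r j * D j"
      unfolding id_block_col_Suc[OF True]
      by (rule append_rows_mult[OF id_block_col_carrier[of l r j] zero_carrier_mat D(3), symmetric])
    finally show ?thesis .
  next
    case False
    then have j: "j = l" using Suc.prems by simp
    have "diag_block_mat (map D [0..<Suc l]) * id_block_col (Suc l) c l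
        = (?B * 0\<^sub>m (\<Sum>i<l. c i) (c l)) @\<^sub>r (D l * 1\<^sub>m (c l))"
      unfolding BS id_block_col_last
      by (rule diag_mult_append_rows[OF B D(2)]) auto
    also have "\<dots> = (0\<^sub>m (\<Sum>i<l. r i) (r l) * D l) @\<^sub>r (1\<^sub>m (r l) * D l)"
      using B D by simp
    also have "\<dots> = id_block_col (Suc l) r l * D l"
      unfolding id_block_col_last
      by (rule append_rows_mult[OF zero_carrier_mat one_carrier_mat D(2), symmetric])
    finally show ?thesis unfolding j .
  qed
qed simp

section \<open>Nonnegativity of the multipliers on the graph of the uncertainty\<close>

lemma qmi_set_quad_form:
  assumes \<Delta>: "\<Delta> \<in> qmi_set p q PP" and P: "P \<in> PP" "P \<in> carrier_mat (q + p) (q + p)"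
    and y: "y \<in> carrier_vec p"
  shows "quad_form P ((\<Delta>\<^sup>T *\<^sub>v y) @\<^sub>v y) \<ge> 0"
proof -
  have c: "\<Delta>\<^sup>T \<in> carrier_mat q p"
    and psd: "pos_semidef p ((\<Delta>\<^sup>T @\<^sub>r 1\<^sub>m p)\<^sup>T * P * (\<Delta>\<^sup>T @\<^sub>r 1\<^sub>m p))"
    using \<Delta> P by (auto simp: qmi_set_def)
  have "0 \<le> quad_form P ((\<Delta>\<^sup>T @\<^sub>r 1\<^sub>m p) *\<^sub>v y)"
    using pos_semidef_quad_form[OF psd y] quad_form_congruence[OF P(2) _ y] c by auto
  also have "(\<Delta>\<^sup>T @\<^sub>r 1\<^sub>m p) *\<^sub>v y = (\<Delta>\<^sup>T *\<^sub>v y) @\<^sub>v y"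
    using mat_mult_append[OF c one_carrier_mat y] y by simp
  finally show ?thesis .
qed

lemma multiplier_class_carrier:
  "multiplier_class p q PP \<Longrightarrow> P \<in> PP \<Longrightarrow> P \<in> carrier_mat (q + p) (q + p)"
  by (auto simp: multiplier_class_def sym_convex_cone_def sym_mat_def)

lemma Delta_prior_carrier:
  assumes "\<Delta> \<in> Delta_prior l nwj nzj PP"
  shows "\<Delta> \<in> carrier_mat (\<Sum>j<l. nwj j) (\<Sum>j<l. nzj j)"
  using assms unfolding Delta_prior_def
  by (auto intro!: diag_block_mat_upt_carrier simp: qmi_set_def)

lemma mult_prior_carrier:
  "P \<in> mult_prior G n l nwj nzj PP \<Longrightarrow> P \<in> carrier_mat ((\<Sum>j<l. nzj j) + n) ((\<Sum>j<l. nzj j) + n)"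
  by (auto simp: mult_prior_def mat_sum_def Let_def)

lemma mult_learnt_carrier:
  assumes "pBd G \<in> carrier_mat n nd" "M \<in> carrier_mat n N" "Z \<in> carrier_mat nz N"
    and "multiplier_class nd N PPd" "P \<in> mult_learnt G nd nz PPd M Z"
  shows "P \<in> carrier_mat (nz + n) (nz + n)"
proof -
  define T where "T = four_block_mat (- (Z\<^sup>T)) (M\<^sup>T) (0\<^sub>m nd nz) ((pBd G)\<^sup>T)"
  obtain Q where Q: "Q \<in> PPd" and P_eq: "P = T\<^sup>T * Q * T"
    using assms unfolding mult_learnt_def T_def Let_def by blast
  have "T \<in> carrier_mat (N + nd) (nz + n)"
    using assms by (auto simp: T_def)
  then show ?thesis
    unfolding P_eq using multiplier_class_carrier[OF assms(4) Q] by auto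
qed

text \<open>Put p = \<Delta>^T Bw^T \<xi>. The j-th outer factor maps (p, \<xi>) to (D_j^T y, y)
  with y = (Bw R_j)^T \<xi>, because L_j^T \<Delta>^T = D_j^T R_j^T. Each summand is therefore an
  instance of the quadratic inequality defining the j-th uncertainty set.\<close>

lemma mult_prior_nonneg:
  assumes Bw: "pBw G \<in> carrier_mat n nw" and nw: "nw = (\<Sum>j<l. nwj j)" and nz: "nz = (\<Sum>j<l. nzj j)"
    and cls: "\<And>j. j < l \<Longrightarrow> multiplier_class (nwj j) (nzj j) (PP j)"
    and \<Delta>: "\<Delta> \<in> Delta_prior l nwj nzj PP" and P: "P \<in> mult_prior G n l nwj nzj PP"
    and \<xi>: "\<xi> \<in> carrier_vec n"
  shows "quad_form P ((\<Delta>\<^sup>T *\<^sub>v ((pBw G)\<^sup>T *\<^sub>v \<xi>)) @\<^sub>v \<xi>) \<ge> 0"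
proof -
  let ?L = "id_block_col l nzj" and ?R = "id_block_col l nwj"
  define T where "T j = four_block_mat ((?L j)\<^sup>T) (0\<^sub>m (nzj j) n) (0\<^sub>m (nwj j) nz)
    ((pBw G * ?R j)\<^sup>T)" for j
  obtain Q where Q: "\<And>j. j < l \<Longrightarrow> Q j \<in> PP j"
    and P_eq: "P = mat_sum (nz + n) (nz + n) (\<lambda>j. (T j)\<^sup>T * Q j * T j) {..<l}"
    using P unfolding mult_prior_def T_def nz Let_def by blast
  obtain D where D: "\<And>j. j < l \<Longrightarrow> D j \<in> qmi_set (nwj j) (nzj j) (PP j)"
    and \<Delta>_eq: "\<Delta> = diag_block_mat (map D [0..<l])"
    using \<Delta> unfolding Delta_prior_def by blast
  have Dc: "D j \<in> carrier_mat (nwj j) (nzj j)" if "j < l" for j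
    using D[OF that] by (simp add: qmi_set_def)
  have \<Delta>c: "\<Delta> \<in> carrier_mat nw nz"
    using Delta_prior_carrier[OF \<Delta>] nw nz by simp
  have Lc: "?L j \<in> carrier_mat nz (nzj j)" and Rc: "?R j \<in> carrier_mat nw (nwj j)" for j
    by (simp_all add: nw nz)
  define p where "p = \<Delta>\<^sup>T *\<^sub>v ((pBw G)\<^sup>T *\<^sub>v \<xi>)"
  have pc: "p \<in> carrier_vec nz"
    using \<Delta>c Bw \<xi> by (simp add: p_def)
  have Tc: "T j \<in> carrier_mat (nzj j + nwj j) (nz + n)" for j
    using Lc Rc Bw by (auto simp: T_def)
  have Qc: "Q j \<in> carrier_mat (nzj j + nwj j) (nzj j + nwj j)" if "j < l" for j
    using multiplier_class_carrier[OF cls[OF that] Q[OF that]] .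
  have nonneg: "quad_form ((T j)\<^sup>T * Q j * T j) (p @\<^sub>v \<xi>) \<ge> 0" if j: "j < l" for j
  proof -
    let ?y = "(pBw G * ?R j)\<^sup>T *\<^sub>v \<xi>"
    have y: "?y \<in> carrier_vec (nwj j)"
      using mult_carrier_mat[OF Bw Rc[of j]] \<xi> by (simp only: mult_mat_vec_carrier transpose_carrier_mat)
    have "(?L j)\<^sup>T * \<Delta>\<^sup>T = (D j)\<^sup>T * (?R j)\<^sup>T"
      using arg_cong[OF diag_block_mat_id_block_col[of l D nwj nzj j, OF Dc j], of transpose_mat]
        transpose_mult[OF \<Delta>c Lc[of j]] transpose_mult[OF Rc[of j] Dc[OF j]]
      by (simp add: \<Delta>_eq)
    moreover have "(?L j)\<^sup>T *\<^sub>v p = ((?L j)\<^sup>T * \<Delta>\<^sup>T) *\<^sub>v ((pBw G)\<^sup>T *\<^sub>v \<xi>)"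
      unfolding p_def using Lc[of j] \<Delta>c Bw \<xi>
      by (intro assoc_mult_mat_vec[symmetric, of _ "nzj j" nz _ nw]) auto
    moreover have "((D j)\<^sup>T * (?R j)\<^sup>T) *\<^sub>v ((pBw G)\<^sup>T *\<^sub>v \<xi>)
        = (D j)\<^sup>T *\<^sub>v ((?R j)\<^sup>T *\<^sub>v ((pBw G)\<^sup>T *\<^sub>v \<xi>))"
      using Rc[of j] Dc[OF j] Bw \<xi>
      by (intro assoc_mult_mat_vec[of _ "nzj j" "nwj j" _ nw]) auto
    moreover have "(?R j)\<^sup>T *\<^sub>v ((pBw G)\<^sup>T *\<^sub>v \<xi>) = ?y"
      using Rc[of j] Bw \<xi> transpose_mult[OF Bw Rc[of j]]
      by (simp add: assoc_mult_mat_vec[of _ "nwj j" nw _ n])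
    ultimately have Lp: "(?L j)\<^sup>T *\<^sub>v p = (D j)\<^sup>T *\<^sub>v ?y" by simp
    have "T j *\<^sub>v (p @\<^sub>v \<xi>) = ((?L j)\<^sup>T *\<^sub>v p + 0\<^sub>m (nzj j) n *\<^sub>v \<xi>) @\<^sub>v (0\<^sub>m (nwj j) nz *\<^sub>v p + ?y)"
      unfolding T_def using Lc[of j] Rc[of j] Bw pc \<xi>
      by (intro four_block_mat_mult_vec[of _ "nzj j" nz _ n _ "nwj j"]) auto
    also have "\<dots> = ((D j)\<^sup>T *\<^sub>v ?y) @\<^sub>v ?y"
      using zero_mat_mult_vec pc \<xi> y Dc[OF j] Lp by simp
    finally show ?thesis
      using quad_form_congruence[OF Qc[OF j] Tc[of j], of "p @\<^sub>v \<xi>"] pc \<xi>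
        qmi_set_quad_form[OF D[OF j] Q[OF j] Qc[OF j] y] by simp
  qed
  have "quad_form P (p @\<^sub>v \<xi>) = (\<Sum>j<l. quad_form ((T j)\<^sup>T * Q j * T j) (p @\<^sub>v \<xi>))"
  proof (unfold P_eq, rule quad_form_mat_sum)
    fix j assume "j \<in> {..<l}"
    then show "(T j)\<^sup>T * Q j * T j \<in> carrier_mat (nz + n) (nz + n)"
      using Qc[of j] Tc[of j] by auto
  qed (use pc \<xi> in auto)
  also have "\<dots> \<ge> 0"
    using nonneg by (intro sum_nonneg) auto
  finally show "quad_form P ((\<Delta>\<^sup>T *\<^sub>v ((pBw G)\<^sup>T *\<^sub>v \<xi>)) @\<^sub>v \<xi>) \<ge> 0"
    by (simp add: p_def)
qed

text \<open>Any disturbance matrix D that explains the data with \<Delta> may be used. Transposing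
  the data equation gives M^T \<xi> - Z^T p = D^T y with y = Bd^T \<xi>, so the outer factor maps
  (p, \<xi>) to (D^T y, y), where the inequality defining the disturbance set applies.\<close>

lemma mult_learnt_nonneg:
  assumes Bw: "pBw G \<in> carrier_mat n nw" and Bd: "pBd G \<in> carrier_mat n nd"
    and M: "M \<in> carrier_mat n N" and Z: "Z \<in> carrier_mat nz N"
    and cls: "multiplier_class nd N PPd"
    and \<Delta>: "\<Delta> \<in> Delta_learnt G nw nz (qmi_set nd N PPd) M Z"
    and P: "P \<in> mult_learnt G nd nz PPd M Z" and \<xi>: "\<xi> \<in> carrier_vec n"
  shows "quad_form P ((\<Delta>\<^sup>T *\<^sub>v ((pBw G)\<^sup>T *\<^sub>v \<xi>)) @\<^sub>v \<xi>) \<ge> 0"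
proof -
  define T where "T = four_block_mat (- (Z\<^sup>T)) (M\<^sup>T) (0\<^sub>m nd nz) ((pBd G)\<^sup>T)"
  obtain Q where Q: "Q \<in> PPd" and P_eq: "P = T\<^sup>T * Q * T"
    using P unfolding mult_learnt_def T_def Let_def by blast
  have Tc: "T \<in> carrier_mat (N + nd) (nz + n)"
    using Z M Bd by (auto simp: T_def)
  have Qc: "Q \<in> carrier_mat (N + nd) (N + nd)"
    by (rule multiplier_class_carrier[OF cls Q])
  obtain D where D: "D \<in> qmi_set nd N PPd" and M_eq: "M = pBw G * \<Delta> * Z + pBd G * D"
    and \<Delta>c: "\<Delta> \<in> carrier_mat nw nz"
    using \<Delta> by (auto simp: Delta_learnt_def)
  have Dc: "D \<in> carrier_mat nd N" using D by (simp add: qmi_set_def)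
  define p where "p = \<Delta>\<^sup>T *\<^sub>v ((pBw G)\<^sup>T *\<^sub>v \<xi>)"
  let ?y = "(pBd G)\<^sup>T *\<^sub>v \<xi>"
  have pc: "p \<in> carrier_vec nz" and y: "?y \<in> carrier_vec nd"
    using \<Delta>c Bw Bd \<xi> by (simp_all add: p_def)
  have "M\<^sup>T = Z\<^sup>T * (\<Delta>\<^sup>T * (pBw G)\<^sup>T) + D\<^sup>T * (pBd G)\<^sup>T"
    using transpose_add[OF mult_carrier_mat[OF mult_carrier_mat[OF Bw \<Delta>c] Z] mult_carrier_mat[OF Bd Dc]]
      transpose_mult[OF mult_carrier_mat[OF Bw \<Delta>c] Z] transpose_mult[OF Bw \<Delta>c] transpose_mult[OF Bd Dc]
    unfolding M_eq by simp
  moreover have "(Z\<^sup>T * (\<Delta>\<^sup>T * (pBw G)\<^sup>T) + D\<^sup>T * (pBd G)\<^sup>T) *\<^sub>v \<xi>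
      = (Z\<^sup>T * (\<Delta>\<^sup>T * (pBw G)\<^sup>T)) *\<^sub>v \<xi> + (D\<^sup>T * (pBd G)\<^sup>T) *\<^sub>v \<xi>"
    using Bw \<Delta>c Z Bd Dc \<xi> by (intro add_mult_distrib_mat_vec[of _ N n]) auto
  moreover have "(Z\<^sup>T * (\<Delta>\<^sup>T * (pBw G)\<^sup>T)) *\<^sub>v \<xi> = Z\<^sup>T *\<^sub>v p"
    using Bw \<Delta>c Z \<xi> unfolding p_def
    by (simp add: assoc_mult_mat_vec[of _ N nz _ n] assoc_mult_mat_vec[of _ nz nw _ n])
  moreover have "(D\<^sup>T * (pBd G)\<^sup>T) *\<^sub>v \<xi> = D\<^sup>T *\<^sub>v ?y"
    using Bd Dc \<xi> by (simp add: assoc_mult_mat_vec[of _ N nd _ n])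
  ultimately have "M\<^sup>T *\<^sub>v \<xi> = Z\<^sup>T *\<^sub>v p + D\<^sup>T *\<^sub>v ?y" by simp
  then have Mxi: "- (Z\<^sup>T) *\<^sub>v p + M\<^sup>T *\<^sub>v \<xi> = D\<^sup>T *\<^sub>v ?y"
    using Z pc Dc y by (intro eq_vecI) auto
  have "T *\<^sub>v (p @\<^sub>v \<xi>) = (- (Z\<^sup>T) *\<^sub>v p + M\<^sup>T *\<^sub>v \<xi>) @\<^sub>v (0\<^sub>m nd nz *\<^sub>v p + ?y)"
    unfolding T_def using Z M Bd pc \<xi>
    by (intro four_block_mat_mult_vec[of _ N nz _ n _ nd]) auto
  also have "\<dots> = (D\<^sup>T *\<^sub>v ?y) @\<^sub>v ?y"
    using zero_mat_mult_vec pc y Mxi by simp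
  finally show "quad_form P ((\<Delta>\<^sup>T *\<^sub>v ((pBw G)\<^sup>T *\<^sub>v \<xi>)) @\<^sub>v \<xi>) \<ge> 0"
    using quad_form_congruence[OF Qc Tc, of "p @\<^sub>v \<xi>"] pc \<xi> qmi_set_quad_form[OF D Q Qc y]
    by (simp add: P_eq p_def)
qed

lemma data_X_carrier: "data_X n N x \<in> carrier_mat n N"
  using mat_of_cols_carrier(1)[of n "map x [0..<N]"] by (simp add: data_X_def)

lemma data_carrier:
  assumes "plant_dims G n m nd ne nw nz nw' nz'"
  shows "data_M G n m nw' N \<Delta>' x u \<in> carrier_mat n N" "data_Z G n m nw' N \<Delta>' x u \<in> carrier_mat nz N"
  using assms data_X_carrier unfolding plant_dims_def data_M_def data_Z_def
  by (auto intro!: minus_carrier_mat mult_carrier_mat add_carrier_mat)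

section \<open>The closed loop and its adjoint\<close>

lemma closed_loop_mult_vec:
  fixes A :: "real mat"
  assumes "A \<in> carrier_mat p n" "B \<in> carrier_mat p m" "K \<in> carrier_mat m n" "x \<in> carrier_vec n"
  shows "(A + B * K) *\<^sub>v x = A *\<^sub>v x + B *\<^sub>v (K *\<^sub>v x)"
  using assms by (simp add: add_mult_distrib_mat_vec[of _ p n])

lemma next_state_carrier:
  assumes "plant_dims G n m nd ne nw nz nw' nz'"
  shows "next_state G \<Delta> \<Delta>' x u d \<in> carrier_vec n" "out_e G x u d \<in> carrier_vec ne"
proof -
  \<comment> \<open>The dimension of a sum of vectors is read off its last summand, so these two
    matrices settle both claims for arbitrary x, u and d.\<close>
  have "pBw' G \<in> carrier_mat n nw'" "pDed G \<in> carrier_mat ne nd"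
    using assms unfolding plant_dims_def by blast+
  then show "next_state G \<Delta> \<Delta>' x u d \<in> carrier_vec n" "out_e G x u d \<in> carrier_vec ne"
    by (auto intro!: carrier_vecI simp: next_state_def out_e_def)
qed

text \<open>At a fixed x the value of \<Delta>' is just a matrix, so every map can be moved across
  the scalar product despite the nonlinearity. The products of internal signals satisfy p' . z' =
  (Bw'^T \<xi> + Dzw'^T p) . w' and p . z = (Bw^T \<xi>) . w, and they cancel when all terms are
  collected.\<close>

lemma closed_loop_adjoint:
  assumes dims: "plant_dims G n m nd ne nw nz nw' nz'" and K: "K \<in> carrier_mat m n"
    and x: "x \<in> carrier_vec n" and d: "d \<in> carrier_vec nd"
    and \<Delta>: "\<Delta> \<in> carrier_mat nw nz" and \<Delta>': "\<Delta>' x \<in> carrier_mat nw' nz'"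
    and \<xi>: "\<xi> \<in> carrier_vec n" and \<eta>: "\<eta> \<in> carrier_vec ne"
    and p_def: "p = \<Delta>\<^sup>T *\<^sub>v ((pBw G)\<^sup>T *\<^sub>v \<xi>)"
    and p'_def: "p' = (\<Delta>' x)\<^sup>T *\<^sub>v ((pBw' G)\<^sup>T *\<^sub>v \<xi> + (pDzw' G)\<^sup>T *\<^sub>v p)"
    and a_def: "a = (pA G + pB G * K)\<^sup>T *\<^sub>v \<xi> + ((pCz' G + pDz' G * K)\<^sup>T *\<^sub>v p'
      + ((pCz G + pDz G * K)\<^sup>T *\<^sub>v p + (pCe G + pDeu G * K)\<^sup>T *\<^sub>v \<eta>))"
    and q_def: "q = (pBd G)\<^sup>T *\<^sub>v \<xi> + (pDed G)\<^sup>T *\<^sub>v \<eta>"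
  shows "a \<bullet> x + q \<bullet> d
    = \<xi> \<bullet> next_state G \<Delta> \<Delta>' x (K *\<^sub>v x) d + \<eta> \<bullet> out_e G x (K *\<^sub>v x) d"
proof -
  have G: "pA G \<in> carrier_mat n n" "pB G \<in> carrier_mat n m" "pBd G \<in> carrier_mat n nd"
     "pBw G \<in> carrier_mat n nw" "pBw' G \<in> carrier_mat n nw'"
     "pCe G \<in> carrier_mat ne n" "pDeu G \<in> carrier_mat ne m" "pDed G \<in> carrier_mat ne nd"
     "pCz G \<in> carrier_mat nz n" "pDz G \<in> carrier_mat nz m" "pDzw' G \<in> carrier_mat nz nw'"
     "pCz' G \<in> carrier_mat nz' n" "pDz' G \<in> carrier_mat nz' m"
    using dims by (auto simp: plant_dims_def)
  define u where "u = K *\<^sub>v x"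
  define z' where "z' = out_z' G x u"
  define w' where "w' = in_w' G \<Delta>' x u"
  define z where "z = out_z G \<Delta>' x u"
  define w where "w = in_w G \<Delta> \<Delta>' x u"
  define AK where "AK = pA G + pB G * K"
  define CK' where "CK' = pCz' G + pDz' G * K"
  define CK where "CK = pCz G + pDz G * K"
  define EK where "EK = pCe G + pDeu G * K"
  note defs = AK_def[symmetric] CK'_def[symmetric] CK_def[symmetric] EK_def[symmetric]
  have cK: "AK \<in> carrier_mat n n" "CK' \<in> carrier_mat nz' n" "CK \<in> carrier_mat nz n"
    "EK \<in> carrier_mat ne n"
    using G K by (auto simp: AK_def CK'_def CK_def EK_def)
  define r where "r = (pBw' G)\<^sup>T *\<^sub>v \<xi> + (pDzw' G)\<^sup>T *\<^sub>v p"
  have u: "u \<in> carrier_vec m" using K x by (simp add: u_def)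
  have z': "z' = CK' *\<^sub>v x"
    unfolding z'_def out_z'_def u_def CK'_def by (rule closed_loop_mult_vec[OF G(12,13) K x, symmetric])
  have w': "w' = \<Delta>' x *\<^sub>v z'"
    by (simp add: w'_def in_w'_def z'_def)
  have z: "z = CK *\<^sub>v x + pDzw' G *\<^sub>v w'"
    unfolding z_def out_z_def u_def CK_def w'_def closed_loop_mult_vec[OF G(9,10) K x] by simp
  have w: "w = \<Delta> *\<^sub>v z"
    by (simp add: w_def in_w_def z_def)
  have xp: "next_state G \<Delta> \<Delta>' x u d = AK *\<^sub>v x + pBd G *\<^sub>v d + pBw G *\<^sub>v w + pBw' G *\<^sub>v w'"
    unfolding next_state_def w_def w'_def AK_def u_def closed_loop_mult_vec[OF G(1,2) K x] by simp
  have e: "out_e G x u d = EK *\<^sub>v x + pDed G *\<^sub>v d"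
    unfolding out_e_def EK_def u_def closed_loop_mult_vec[OF G(6,7) K x] by simp
  have cv: "z' \<in> carrier_vec nz'" "w' \<in> carrier_vec nw'" "z \<in> carrier_vec nz" "w \<in> carrier_vec nw"
    "p \<in> carrier_vec nz" "r \<in> carrier_vec nw'" "p' \<in> carrier_vec nz'"
    "(pBw G)\<^sup>T *\<^sub>v \<xi> \<in> carrier_vec nw"
    using cK x \<Delta>' \<Delta> G \<xi> by (auto simp: z' w' z w p_def r_def p'_def)
  note tr = transpose_vec_mult_scalar
  have "a \<bullet> x = (AK\<^sup>T *\<^sub>v \<xi>) \<bullet> x + ((CK'\<^sup>T *\<^sub>v p') \<bullet> x + ((CK\<^sup>T *\<^sub>v p) \<bullet> x + (EK\<^sup>T *\<^sub>v \<eta>) \<bullet> x))"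
    unfolding a_def defs using cK cv \<xi> \<eta> x
    by (simp add: add_scalar_prod_distrib[of _ n])
  also have "\<dots> = \<xi> \<bullet> (AK *\<^sub>v x) + (p' \<bullet> z' + (p \<bullet> (CK *\<^sub>v x) + \<eta> \<bullet> (EK *\<^sub>v x)))"
    by (simp only: z' tr[OF cK(1) x \<xi>] tr[OF cK(2) x cv(7)] tr[OF cK(3) x cv(5)] tr[OF cK(4) x \<eta>])
  finally have ax: "a \<bullet> x = \<xi> \<bullet> (AK *\<^sub>v x) + (p' \<bullet> z' + (p \<bullet> (CK *\<^sub>v x) + \<eta> \<bullet> (EK *\<^sub>v x)))" .
  have "p' \<bullet> z' = r \<bullet> w'"
    unfolding p'_def r_def[symmetric] w' by (rule tr[OF \<Delta>' cv(1) cv(6)])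
  also have "\<dots> = ((pBw' G)\<^sup>T *\<^sub>v \<xi>) \<bullet> w' + ((pDzw' G)\<^sup>T *\<^sub>v p) \<bullet> w'"
    unfolding r_def using G \<xi> cv by (intro add_scalar_prod_distrib[of _ nw']) auto
  also have "\<dots> = \<xi> \<bullet> (pBw' G *\<^sub>v w') + p \<bullet> (pDzw' G *\<^sub>v w')"
    by (simp only: tr[OF G(5) cv(2) \<xi>] tr[OF G(11) cv(2,5)])
  finally have pz': "p' \<bullet> z' = \<xi> \<bullet> (pBw' G *\<^sub>v w') + p \<bullet> (pDzw' G *\<^sub>v w')" .
  have "p \<bullet> z = p \<bullet> (CK *\<^sub>v x) + p \<bullet> (pDzw' G *\<^sub>v w')"
    unfolding z using cK G cv x by (intro scalar_prod_add_distrib[of _ nz]) auto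
  moreover have "p \<bullet> z = \<xi> \<bullet> (pBw G *\<^sub>v w)"
    unfolding p_def w by (simp only: tr[OF \<Delta> cv(3,8)] tr[OF G(4) _ \<xi>] cv(4)[unfolded w])
  moreover have "q \<bullet> d = \<xi> \<bullet> (pBd G *\<^sub>v d) + \<eta> \<bullet> (pDed G *\<^sub>v d)"
  proof -
    have "q \<bullet> d = ((pBd G)\<^sup>T *\<^sub>v \<xi>) \<bullet> d + ((pDed G)\<^sup>T *\<^sub>v \<eta>) \<bullet> d"
      unfolding q_def using G d \<xi> \<eta> by (intro add_scalar_prod_distrib[of _ nd]) auto
    then show ?thesis
      by (simp only: tr[OF G(3) d \<xi>] tr[OF G(8) d \<eta>])
  qed
  moreover have "\<xi> \<bullet> next_state G \<Delta> \<Delta>' x u d = \<xi> \<bullet> (AK *\<^sub>v x) + \<xi> \<bullet> (pBd G *\<^sub>v d)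
      + \<xi> \<bullet> (pBw G *\<^sub>v w) + \<xi> \<bullet> (pBw' G *\<^sub>v w')"
    unfolding xp using G cK cv x d \<xi> by (simp add: scalar_prod_add_distrib[of _ n])
  moreover have "\<eta> \<bullet> out_e G x u d = \<eta> \<bullet> (EK *\<^sub>v x) + \<eta> \<bullet> (pDed G *\<^sub>v d)"
    unfolding e using G cK x d \<eta> by (simp add: scalar_prod_add_distrib[of _ ne])
  ultimately show ?thesis
    using ax pz' unfolding u_def by linarith
qed

section \<open>Consequences of scalar decay estimates for the storage function\<close>

lemma glob_asymp_stable_contraction:
  assumes X: "pos_def n X" and \<rho>: "0 \<le> \<rho>" "\<rho> < 1"
    and \<phi>: "\<And>x0 k. x0 \<in> carrier_vec n \<Longrightarrow> \<phi> x0 k \<in> carrier_vec n"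
    and \<phi>0: "\<And>x0. x0 \<in> carrier_vec n \<Longrightarrow> \<phi> x0 0 = x0"
    and step: "\<And>x0 k. x0 \<in> carrier_vec n \<Longrightarrow>
      quad_form X (\<phi> x0 (Suc k)) \<le> \<rho> * quad_form X (\<phi> x0 k)"
  shows "glob_asymp_stable n \<phi>"
proof -
  obtain c where c: "c > 0" "\<And>v. v \<in> carrier_vec n \<Longrightarrow> c * (v \<bullet> v) \<le> quad_form X v"
    using pos_def_lower_bound[OF X] by blast
  obtain C where C: "C > 0" "\<And>v. v \<in> carrier_vec n \<Longrightarrow> \<bar>quad_form X v\<bar> \<le> C * (v \<bullet> v)"
    using quad_form_bound[of X n] X by (auto simp: pos_def_def sym_mat_def)
  have decay: "quad_form X (\<phi> x0 k) \<le> \<rho> ^ k * quad_form X x0" if "x0 \<in> carrier_vec n" for x0 k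
  proof (induction k)
    case (Suc k)
    have "quad_form X (\<phi> x0 (Suc k)) \<le> \<rho> * (\<rho> ^ k * quad_form X x0)"
      using step[OF that, of k] mult_left_mono[OF Suc \<rho>(1)] by linarith
    then show ?case by simp
  qed (simp add: \<phi>0[OF that])
  have bound: "\<phi> x0 k \<bullet> \<phi> x0 k \<le> \<rho> ^ k * (C / c * (x0 \<bullet> x0))" if x0: "x0 \<in> carrier_vec n" for x0 k
  proof -
    have "c * (\<phi> x0 k \<bullet> \<phi> x0 k) \<le> \<rho> ^ k * quad_form X x0"
      using c(2)[OF \<phi>[OF x0, of k]] decay[OF x0, of k] by linarith
    also have "\<dots> \<le> \<rho> ^ k * (C * (x0 \<bullet> x0))"
      using C(2)[OF x0] \<rho> by (intro mult_left_mono) auto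
    finally show ?thesis using c(1) by (simp add: field_simps)
  qed
  show ?thesis
    unfolding glob_asymp_stable_def
  proof (intro conjI allI impI ballI)
    fix \<epsilon> :: real assume \<epsilon>: "\<epsilon> > 0"
    \<comment> \<open>Trajectories overshoot the initial norm by at most the factor sqrt (C / c),
      the ratio of the two bounds comparing the form with the squared length.\<close>
    define \<delta> where "\<delta> = \<epsilon> / sqrt (C / c)"
    have "\<delta> > 0" using \<epsilon> c C by (simp add: \<delta>_def)
    moreover have "vec_norm (\<phi> x0 k) < \<epsilon>"
      if x0: "x0 \<in> carrier_vec n" and lt: "vec_norm x0 < \<delta>" for x0 k
    proof -
      have "\<phi> x0 k \<bullet> \<phi> x0 k \<le> 1 * (C / c * (x0 \<bullet> x0))"
        using power_le_one[of \<rho> k] \<rho> c C scalar_prod_self_nonneg[of x0]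
        by (intro order_trans[OF bound[OF x0, of k]] mult_right_mono) auto
      then have "vec_norm (\<phi> x0 k) \<le> sqrt (C / c) * vec_norm x0"
        unfolding vec_norm_def by (metis mult_1 real_sqrt_le_mono real_sqrt_mult)
      also have "\<dots> < sqrt (C / c) * \<delta>"
        using lt c C by (intro mult_strict_left_mono) auto
      also have "\<dots> = \<epsilon>" using c C by (simp add: \<delta>_def)
      finally show ?thesis .
    qed
    ultimately show "\<exists>\<delta>>0. \<forall>x0\<in>carrier_vec n. vec_norm x0 < \<delta> \<longrightarrow> (\<forall>k. vec_norm (\<phi> x0 k) < \<epsilon>)"
      by blast
  next
    fix x0 :: "real vec" assume x0: "x0 \<in> carrier_vec n"
    have "(\<lambda>k. \<rho> ^ k * (C / c * (x0 \<bullet> x0))) \<longlonglongrightarrow> 0 * (C / c * (x0 \<bullet> x0))"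
      using \<rho> by (intro tendsto_mult LIMSEQ_realpow_zero tendsto_const)
    then have lim: "(\<lambda>k. \<rho> ^ k * (C / c * (x0 \<bullet> x0))) \<longlonglongrightarrow> 0"
      by (simp only: mult_zero_left)
    have "(\<lambda>k. \<phi> x0 k \<bullet> \<phi> x0 k) \<longlonglongrightarrow> 0"
      by (rule tendsto_sandwich[OF _ _ tendsto_const lim])
        (simp_all only: scalar_prod_self_nonneg bound[OF x0] eventually_sequentially, blast+)
    from tendsto_real_sqrt[OF this] show "(\<lambda>k. vec_norm (\<phi> x0 k)) \<longlonglongrightarrow> 0"
      by (simp add: vec_norm_def)
  qed
qed

text \<open>The partial sum S of \<open>V\<close> up to k is at most the one up to k + 1, which the
  recursion bounds by V 0 + \<rho> S + c times the series of \<open>D\<close>. Since \<rho> < 1,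
  this can be solved for S, and the bound does not depend on k.\<close>

lemma summable_linear_recursion:
  fixes V D :: "nat \<Rightarrow> real"
  assumes nn: "\<And>k. V k \<ge> 0" "\<And>k. D k \<ge> 0" and "summable D" and \<rho>: "0 \<le> \<rho>" "\<rho> < 1" and "c \<ge> 0"
    and step: "\<And>k. V (Suc k) \<le> \<rho> * V k + c * D k"
  shows "summable V"
proof (rule bounded_imp_summable)
  fix k
  have "(\<Sum>i\<le>k. V i) \<le> (\<Sum>i\<le>Suc k. V i)" using nn by simp
  also have "\<dots> = V 0 + (\<Sum>i\<le>k. V (Suc i))" by (rule sum.atMost_Suc_shift)
  also have "\<dots> \<le> V 0 + (\<Sum>i\<le>k. \<rho> * V i + c * D i)"
    by (intro add_left_mono sum_mono step)
  also have "\<dots> = V 0 + \<rho> * (\<Sum>i\<le>k. V i) + c * (\<Sum>i\<le>k. D i)"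
    by (simp add: sum.distrib sum_distrib_left)
  also have "\<dots> \<le> V 0 + \<rho> * (\<Sum>i\<le>k. V i) + c * suminf D"
    using assms by (intro add_left_mono mult_left_mono sum_le_suminf) auto
  finally show "(\<Sum>i\<le>k. V i) \<le> (V 0 + c * suminf D) / (1 - \<rho>)"
    using \<rho> by (simp add: field_simps)
qed (use nn in auto)

section \<open>Robust stability and performance\<close>

context dual_pair
begin

text \<open>\<open>DL\<close> may be any set of matrices on whose graphs the form of
  \<open>Pcom\<close> is nonnegative. The constants are fixed before the uncertainties, the state
  and the disturbance are chosen, which is what a uniform performance margin requires.\<close>

lemma robust_dissipation:
  assumes dims: "plant_dims G n m nd ne nw nz nw' nz'" and K: "K \<in> carrier_mat m n"
    and P': "P' \<in> PP'" "P' \<in> carrier_mat (nz' + nw') (nz' + nw')"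
    and Pcom: "Pcom \<in> carrier_mat (nz + n) (nz + n)"
    and DL: "\<And>\<Delta>. \<Delta> \<in> DL \<Longrightarrow> \<Delta> \<in> carrier_mat nw nz"
    and Pcom_nonneg: "\<And>\<Delta> \<xi>. \<Delta> \<in> DL \<Longrightarrow> \<xi> \<in> carrier_vec n \<Longrightarrow>
      quad_form Pcom ((\<Delta>\<^sup>T *\<^sub>v ((pBw G)\<^sup>T *\<^sub>v \<xi>)) @\<^sub>v \<xi>) \<ge> 0"
    and F_def: "F = outer_factor G K n nd ne nz nw' nz'"
    and LMI: "neg_def (n + nz' + nz + ne) (F\<^sup>T * diag_block_mat [- Y, Y, P', Pcom, Ptp] * F)"
  obtains \<rho> c \<gamma> where "0 \<le> \<rho>" "\<rho> < 1" "c > 0" "\<gamma> > 0"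
    "\<And>\<Delta> \<Delta>' x d. \<lbrakk>\<Delta> \<in> DL; \<Delta>' \<in> nonlin_class n nw' nz' PP'; x \<in> carrier_vec n; d \<in> carrier_vec nd\<rbrakk> \<Longrightarrow>
      quad_form X (next_state G \<Delta> \<Delta>' x (K *\<^sub>v x) d) \<le> \<rho> * quad_form X x + c * (d \<bullet> d)"
    "\<And>\<Delta> \<Delta>' x d. \<lbrakk>\<Delta> \<in> DL; \<Delta>' \<in> nonlin_class n nw' nz' PP'; x \<in> carrier_vec n; d \<in> carrier_vec nd\<rbrakk> \<Longrightarrow>
      quad_form X (next_state G \<Delta> \<Delta>' x (K *\<^sub>v x) d) - quad_form X x
        + quad_form Pp (d @\<^sub>v out_e G x (K *\<^sub>v x) d) \<le> - \<gamma> * (d \<bullet> d)"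
proof -
  have G: "pBd G \<in> carrier_mat n nd" "pDed G \<in> carrier_mat ne nd" "pBw G \<in> carrier_mat n nw"
    "pBw' G \<in> carrier_mat n nw'" "pDzw' G \<in> carrier_mat nz nw'"
    using dims by (auto simp: plant_dims_def)
  have Ptp_carrier: "Ptp \<in> carrier_mat (ne + nd) (ne + nd)"
    using Pt_blocks by auto
  obtain \<epsilon> \<delta> where \<epsilon>: "\<epsilon> > 0" and \<delta>: "\<delta> > 0" and margin:
    "\<And>\<xi> p' p \<eta> a. \<lbrakk>\<xi> \<in> carrier_vec n; p' \<in> carrier_vec nz'; p \<in> carrier_vec nz; \<eta> \<in> carrier_vec ne;
      a = (pA G + pB G * K)\<^sup>T *\<^sub>v \<xi> + ((pCz' G + pDz' G * K)\<^sup>T *\<^sub>v p' + ((pCz G + pDz G * K)\<^sup>T *\<^sub>v p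
        + (pCe G + pDeu G * K)\<^sup>T *\<^sub>v \<eta>))\<rbrakk> \<Longrightarrow>
      - quad_form Y \<xi> + (1 + \<delta>) * quad_form Y a
        + quad_form P' (p' @\<^sub>v ((pBw' G)\<^sup>T *\<^sub>v \<xi> + (pDzw' G)\<^sup>T *\<^sub>v p)) + quad_form Pcom (p @\<^sub>v \<xi>)
        + quad_form Ptp (\<eta> @\<^sub>v ((pBd G)\<^sup>T *\<^sub>v \<xi> + (pDed G)\<^sup>T *\<^sub>v \<eta>)) \<le> - \<epsilon> * (\<xi> \<bullet> \<xi> + \<eta> \<bullet> \<eta>)"
    using synthesis_LMI_margin[OF dims K XY_carrier(2) P'(2) Pcom Ptp_carrier F_def LMI] by blast
  \<comment> \<open>The adjoint inequality with the multiplier terms removed, still for arbitrary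
    \<xi> and \<eta>. The signals p and p' stay internal; later steps see only a and the two
    relations it satisfies.\<close>
  have dual: "\<exists>a \<in> carrier_vec n.
      a \<bullet> x + q \<bullet> d = \<xi> \<bullet> next_state G \<Delta> \<Delta>' x (K *\<^sub>v x) d + \<eta> \<bullet> out_e G x (K *\<^sub>v x) d \<and>
      - quad_form Y \<xi> + (1 + \<delta>) * quad_form Y a + quad_form Ptp (\<eta> @\<^sub>v q) \<le> - \<epsilon> * (\<xi> \<bullet> \<xi> + \<eta> \<bullet> \<eta>)"
    if \<Delta>: "\<Delta> \<in> DL" and \<Delta>': "\<Delta>' \<in> nonlin_class n nw' nz' PP'"
      and x: "x \<in> carrier_vec n" and d: "d \<in> carrier_vec nd"
      and \<xi>: "\<xi> \<in> carrier_vec n" and \<eta>: "\<eta> \<in> carrier_vec ne"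
      and q_def: "q = (pBd G)\<^sup>T *\<^sub>v \<xi> + (pDed G)\<^sup>T *\<^sub>v \<eta>"
    for \<Delta> \<Delta>' x d \<xi> \<eta> q
  proof -
    have qmi: "\<Delta>' x \<in> qmi_set nw' nz' PP'"
      using \<Delta>' x by (auto simp: nonlin_class_def)
    then have \<Delta>'c: "\<Delta>' x \<in> carrier_mat nw' nz'" by (simp add: qmi_set_def)
    define p where "p = \<Delta>\<^sup>T *\<^sub>v ((pBw G)\<^sup>T *\<^sub>v \<xi>)"
    define r where "r = (pBw' G)\<^sup>T *\<^sub>v \<xi> + (pDzw' G)\<^sup>T *\<^sub>v p"
    define p' where "p' = (\<Delta>' x)\<^sup>T *\<^sub>v r"
    define a where "a = (pA G + pB G * K)\<^sup>T *\<^sub>v \<xi> + ((pCz' G + pDz' G * K)\<^sup>T *\<^sub>v p'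
      + ((pCz G + pDz G * K)\<^sup>T *\<^sub>v p + (pCe G + pDeu G * K)\<^sup>T *\<^sub>v \<eta>))"
    have cs: "p \<in> carrier_vec nz" "r \<in> carrier_vec nw'" "p' \<in> carrier_vec nz'"
      using DL[OF \<Delta>] G \<xi> \<Delta>'c by (auto simp: p_def r_def p'_def)
    have "a \<in> carrier_vec n"
      unfolding a_def using dims K by (auto simp: plant_dims_def intro!: carrier_vecI)
    moreover have "a \<bullet> x + q \<bullet> d
        = \<xi> \<bullet> next_state G \<Delta> \<Delta>' x (K *\<^sub>v x) d + \<eta> \<bullet> out_e G x (K *\<^sub>v x) d"
      by (rule closed_loop_adjoint[where \<Delta>' = \<Delta>' and x = x, OF dims K x d DL[OF \<Delta>] \<Delta>'c \<xi> \<eta> p_def p'_def[unfolded r_def] a_def q_def])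
    moreover have "quad_form P' (p' @\<^sub>v r) \<ge> 0"
      unfolding p'_def by (rule qmi_set_quad_form[OF qmi P' cs(2)])
    moreover have "quad_form Pcom (p @\<^sub>v \<xi>) \<ge> 0"
      unfolding p_def by (rule Pcom_nonneg[OF \<Delta> \<xi>])
    ultimately show ?thesis
      using margin[OF \<xi> cs(3,1) \<eta> a_def, folded q_def r_def] by force
  qed
  obtain c where c: "c > 0" and state:
    "\<And>x xp d a \<xi> q. \<lbrakk>x \<in> carrier_vec n; xp \<in> carrier_vec n; d \<in> carrier_vec nd;
      a \<in> carrier_vec n; \<xi> = X *\<^sub>v xp; q = (pBd G)\<^sup>T *\<^sub>v \<xi>; a \<bullet> x + q \<bullet> d = \<xi> \<bullet> xp;
      - quad_form Y \<xi> + (1 + \<delta>) * quad_form Y a + quad_form Ptp (0\<^sub>v ne @\<^sub>v q) \<le> - \<epsilon> * (\<xi> \<bullet> \<xi>)\<rbrakk>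
      \<Longrightarrow> quad_form X xp \<le> quad_form X x / (1 + \<delta>) + c * (d \<bullet> d)"
    using state_dissipation[OF G(1) \<epsilon> \<delta>] by blast
  obtain \<gamma> where \<gamma>: "\<gamma> > 0" and perf:
    "\<And>x xp d e a \<xi> \<eta> q. \<lbrakk>x \<in> carrier_vec n; xp \<in> carrier_vec n; d \<in> carrier_vec nd;
      e \<in> carrier_vec ne; a \<in> carrier_vec n;
      \<xi> = X *\<^sub>v xp; \<eta> = Sp\<^sup>T *\<^sub>v d + Rp *\<^sub>v e; q = (pBd G)\<^sup>T *\<^sub>v \<xi> + (pDed G)\<^sup>T *\<^sub>v \<eta>;
      a \<bullet> x + q \<bullet> d = \<xi> \<bullet> xp + \<eta> \<bullet> e;
      - quad_form Y \<xi> + quad_form Y a + quad_form Ptp (\<eta> @\<^sub>v q) \<le> - \<epsilon> * (\<xi> \<bullet> \<xi> + \<eta> \<bullet> \<eta>)\<rbrakk>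
      \<Longrightarrow> quad_form X xp - quad_form X x + quad_form Pp (d @\<^sub>v e) \<le> - \<gamma> * (d \<bullet> d)"
    using performance_dissipation[OF G(1,2) \<epsilon>] by blast
  show thesis
  proof (rule that[of "1 / (1 + \<delta>)" c \<gamma>])
    show "0 \<le> 1 / (1 + \<delta>)" "1 / (1 + \<delta>) < 1" using \<delta> by auto
    fix \<Delta> \<Delta>' and x d :: "real vec"
    assume \<Delta>: "\<Delta> \<in> DL" and \<Delta>': "\<Delta>' \<in> nonlin_class n nw' nz' PP'"
      and x: "x \<in> carrier_vec n" and d: "d \<in> carrier_vec nd"
    define xp where "xp = next_state G \<Delta> \<Delta>' x (K *\<^sub>v x) d"
    define e where "e = out_e G x (K *\<^sub>v x) d"
    define \<xi> where "\<xi> = X *\<^sub>v xp"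
    define \<eta> where "\<eta> = Sp\<^sup>T *\<^sub>v d + Rp *\<^sub>v e"
    have xp: "xp \<in> carrier_vec n" and e: "e \<in> carrier_vec ne"
      unfolding xp_def e_def by (rule next_state_carrier[OF dims])+
    have \<xi>: "\<xi> \<in> carrier_vec n" and \<eta>: "\<eta> \<in> carrier_vec ne"
      using XY_carrier Pp_blocks xp d e by (auto simp: \<xi>_def \<eta>_def)
    note dual_x = dual[OF \<Delta> \<Delta>' x d \<xi>, folded xp_def e_def]
    have z: "(pDed G)\<^sup>T *\<^sub>v 0\<^sub>v ne = 0\<^sub>v nd" using G by auto
    have q0: "(pBd G)\<^sup>T *\<^sub>v \<xi> = (pBd G)\<^sup>T *\<^sub>v \<xi> + (pDed G)\<^sup>T *\<^sub>v 0\<^sub>v ne"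
      unfolding z using G \<xi> by simp
    obtain a where a: "a \<in> carrier_vec n" "a \<bullet> x + ((pBd G)\<^sup>T *\<^sub>v \<xi>) \<bullet> d = \<xi> \<bullet> xp"
      "- quad_form Y \<xi> + (1 + \<delta>) * quad_form Y a + quad_form Ptp (0\<^sub>v ne @\<^sub>v ((pBd G)\<^sup>T *\<^sub>v \<xi>))
        \<le> - \<epsilon> * (\<xi> \<bullet> \<xi>)"
      using dual_x[OF zero_carrier_vec q0] e by auto
    from state[OF x xp d a(1) \<xi>_def refl a(2,3)]
    show "quad_form X (next_state G \<Delta> \<Delta>' x (K *\<^sub>v x) d) \<le> 1 / (1 + \<delta>) * quad_form X x + c * (d \<bullet> d)"
      by (simp add: xp_def)
    obtain b where b: "b \<in> carrier_vec n"
      "b \<bullet> x + ((pBd G)\<^sup>T *\<^sub>v \<xi> + (pDed G)\<^sup>T *\<^sub>v \<eta>) \<bullet> d = \<xi> \<bullet> xp + \<eta> \<bullet> e"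
      "- quad_form Y \<xi> + (1 + \<delta>) * quad_form Y b
        + quad_form Ptp (\<eta> @\<^sub>v ((pBd G)\<^sup>T *\<^sub>v \<xi> + (pDed G)\<^sup>T *\<^sub>v \<eta>)) \<le> - \<epsilon> * (\<xi> \<bullet> \<xi> + \<eta> \<bullet> \<eta>)"
      using dual_x[OF \<eta> refl] by blast
    have "quad_form Y b \<ge> 0"
      by (rule pos_semidef_quad_form[OF pos_def_imp_pos_semidef[OF Y_pos] b(1)])
    \<comment> \<open>The performance estimate uses coefficient 1 in front of this form, so the
      surplus \<delta> is given away.\<close>
    then have "quad_form Y b \<le> (1 + \<delta>) * quad_form Y b"
      using \<delta> by (simp add: distrib_right)
    then have "- quad_form Y \<xi> + quad_form Y b
        + quad_form Ptp (\<eta> @\<^sub>v ((pBd G)\<^sup>T *\<^sub>v \<xi> + (pDed G)\<^sup>T *\<^sub>v \<eta>)) \<le> - \<epsilon> * (\<xi> \<bullet> \<xi> + \<eta> \<bullet> \<eta>)"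
      using b(3) by linarith
    from perf[OF x xp d e b(1) \<xi>_def \<eta>_def refl b(2) this]
    show "quad_form X (next_state G \<Delta> \<Delta>' x (K *\<^sub>v x) d) - quad_form X x
        + quad_form Pp (d @\<^sub>v out_e G x (K *\<^sub>v x) d) \<le> - \<gamma> * (d \<bullet> d)"
      by (simp add: xp_def e_def)
  qed (use c \<gamma> in auto)
qed

end

lemma cl_state_carrier:
  assumes "plant_dims G n m nd ne nw nz nw' nz'" "x0 \<in> carrier_vec n"
  shows "cl_state G K \<Delta> \<Delta>' x0 d k \<in> carrier_vec n"
  by (cases k) (use assms next_state_carrier in auto)

theorem theorem2:
  fixes G :: plant
    and n m nd ne nw nz nw' nz' l N :: nat
    and nwj nzj :: "nat \<Rightarrow> nat"
    and PP :: "nat \<Rightarrow> real mat set" and PPd PP' :: "real mat set"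
    and \<Delta>tr :: "real mat" and \<Delta>'tr :: "real vec \<Rightarrow> real mat"
    and x u dhat :: "nat \<Rightarrow> real vec"
    and Qp Sp Rp Qt St Rt :: "real mat"
    and Y K Pcom P' :: "real mat"
  defines "M \<equiv> data_M G n m nw' N \<Delta>'tr x u"
    and "Z \<equiv> data_Z G n m nw' N \<Delta>'tr x u"
    and "D_set \<equiv> qmi_set nd N PPd"
    and "D_prior \<equiv> Delta_prior l nwj nzj PP"
    and "D_nonlin \<equiv> nonlin_class n nw' nz' PP'"
  defines "D_com \<equiv> D_prior \<inter> Delta_learnt G nw nz D_set M Z"
    and "Pp \<equiv> four_block_mat Qp Sp (Sp\<^sup>T) Rp"
    and "Ptp \<equiv> four_block_mat (- Rt) (St\<^sup>T) St (- Qt)"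
    and "F \<equiv> outer_factor G K n nd ne nz nw' nz'"
  assumes dims: "plant_dims G n m nd ne nw nz nw' nz'"
    and Bd_rank: "full_col_rank (pBd G)"
    \<comment> \<open>block-diagonal uncertainty: prior knowledge\<close>
    and nw_sum: "nw = (\<Sum>j<l. nwj j)" and nz_sum: "nz = (\<Sum>j<l. nzj j)"
    and Bj_rank: "\<And>j. j < l \<Longrightarrow> full_col_rank (pBw G * id_block_col l nwj j)"
    and PPj_class: "\<And>j. j < l \<Longrightarrow> multiplier_class (nwj j) (nzj j) (PP j)"
    and PPj_neg: "\<And>j. j < l \<Longrightarrow> \<exists>P\<in>PP j. neg_def (nzj j) (upper_left (nzj j) P)"
    \<comment> \<open>disturbance in the data\<close>
    and PPd_class: "multiplier_class nd N PPd"
    and PPd_neg: "\<exists>P\<in>PPd. neg_def N (upper_left N P)"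
    \<comment> \<open>nonlinear uncertainty\<close>
    and PP'_class: "multiplier_class nw' nz' PP'"
    and \<Delta>'tr: "\<Delta>'tr \<in> D_nonlin"
    \<comment> \<open>data generated by the true system\<close>
    and \<Delta>tr: "\<Delta>tr \<in> D_prior"
    and x_dim: "\<And>k. k \<le> N \<Longrightarrow> x k \<in> carrier_vec n"
    and u_dim: "\<And>k. k < N \<Longrightarrow> u k \<in> carrier_vec m"
    and dhat_dim: "\<And>k. k < N \<Longrightarrow> dhat k \<in> carrier_vec nd"
    and Dtr: "mat_of_cols nd (map dhat [0..<N]) \<in> D_set"
    and data: "\<And>k. k < N \<Longrightarrow> x (Suc k) = next_state G \<Delta>tr \<Delta>'tr (x k) (u k) (dhat k)"
    \<comment> \<open>performance index; the second block matrix is the inverse of the first\<close>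
    and Pp_blocks: "Qp \<in> carrier_mat nd nd" "Sp \<in> carrier_mat nd ne" "Rp \<in> carrier_mat ne ne"
    and Pp_sym: "sym_mat (nd + ne) Pp"
    and Pt_blocks: "Qt \<in> carrier_mat nd nd" "St \<in> carrier_mat nd ne" "Rt \<in> carrier_mat ne ne"
    and Pp_inv: "inverts_mat Pp (four_block_mat Qt St (St\<^sup>T) Rt)"
      "inverts_mat (four_block_mat Qt St (St\<^sup>T) Rt) Pp"
    and Qt_neg: "neg_semidef nd Qt"
    \<comment> \<open>feasibility of the synthesis inequality\<close>
    and Y_pos: "pos_def n Y"
    and K_dim: "K \<in> carrier_mat m n"
    and Pcom: "Pcom \<in> mult_com (mult_prior G n l nwj nzj PP) (mult_learnt G nd nz PPd M Z)"
    and P': "P' \<in> PP'"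
    and LMI: "neg_def (n + nz' + nz + ne) (F\<^sup>T * diag_block_mat [- Y, Y, P', Pcom, Ptp] * F)"
  shows "robustly_stable G K n nd D_com D_nonlin
       \<and> robust_quadratic_performance G K n nd D_com D_nonlin Pp"
proof -
  obtain X where X: "pos_def n X" "Y * X = 1\<^sub>m n"
    using pos_def_inverse[OF Y_pos] by blast
  interpret dual_pair n nd ne X Y Qp Sp Rp Qt St Rt
    by unfold_locales (use X Y_pos Pp_blocks Pt_blocks Pp_inv Qt_neg in \<open>auto simp: Pp_def\<close>)
  have G: "pBw G \<in> carrier_mat n nw" "pBd G \<in> carrier_mat n nd"
    and E: "pCe G + pDeu G * K \<in> carrier_mat ne n" "pDed G \<in> carrier_mat ne nd"
    "pCe G \<in> carrier_mat ne n" "pDeu G \<in> carrier_mat ne m"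
    using dims K_dim by (auto simp: plant_dims_def)
  have MZ: "M \<in> carrier_mat n N" "Z \<in> carrier_mat nz N"
    unfolding M_def Z_def by (rule data_carrier[OF dims])+
  obtain P1 P2 where P12: "Pcom = P1 + P2" and P1: "P1 \<in> mult_prior G n l nwj nzj PP"
    and P2: "P2 \<in> mult_learnt G nd nz PPd M Z"
    using Pcom by (auto simp: mult_com_def)
  have P1c: "P1 \<in> carrier_mat (nz + n) (nz + n)"
    using mult_prior_carrier[OF P1] nz_sum by simp
  have P2c: "P2 \<in> carrier_mat (nz + n) (nz + n)"
    by (rule mult_learnt_carrier[OF G(2) MZ PPd_class P2])
  note prior = mult_prior_nonneg[OF G(1) nw_sum nz_sum PPj_class _ P1]
  note learnt = mult_learnt_nonneg[OF G MZ PPd_class _ P2]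
  have DL: "\<Delta> \<in> carrier_mat nw nz" if "\<Delta> \<in> D_com" for \<Delta>
    using that by (simp add: D_com_def Delta_learnt_def)
  \<comment> \<open>Membership in both sets is used: the prior set for the summand
    \<open>P1\<close>, the data equation for the summand \<open>P2\<close>.\<close>
  have Pcom_nonneg: "quad_form Pcom ((\<Delta>\<^sup>T *\<^sub>v ((pBw G)\<^sup>T *\<^sub>v \<xi>)) @\<^sub>v \<xi>) \<ge> 0"
    if \<Delta>: "\<Delta> \<in> D_com" and \<xi>: "\<xi> \<in> carrier_vec n" for \<Delta> \<xi>
  proof -
    let ?v = "(\<Delta>\<^sup>T *\<^sub>v ((pBw G)\<^sup>T *\<^sub>v \<xi>)) @\<^sub>v \<xi>"
    have \<Delta>12: "\<Delta> \<in> Delta_prior l nwj nzj PP" "\<Delta> \<in> Delta_learnt G nw nz (qmi_set nd N PPd) M Z"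
      using \<Delta> by (simp_all add: D_com_def D_prior_def D_set_def)
    have "?v \<in> carrier_vec (nz + n)"
      using DL[OF \<Delta>] G(1) \<xi> by auto
    from quad_form_add_mat[OF P1c P2c this] show ?thesis
      using prior[OF _ \<Delta>12(1) \<xi>] learnt[OF \<Delta>12(2) \<xi>] by (simp add: P12)
  qed
  have Pcom_carrier: "Pcom \<in> carrier_mat (nz + n) (nz + n)"
    using P1c P2c by (simp add: P12)
  obtain \<rho> c \<gamma> where \<rho>: "0 \<le> \<rho>" "\<rho> < 1" and c: "c > 0" and \<gamma>: "\<gamma> > 0" and state:
    "\<And>\<Delta> \<Delta>' x d. \<lbrakk>\<Delta> \<in> D_com; \<Delta>' \<in> D_nonlin; x \<in> carrier_vec n; d \<in> carrier_vec nd\<rbrakk> \<Longrightarrow>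
      quad_form X (next_state G \<Delta> \<Delta>' x (K *\<^sub>v x) d) \<le> \<rho> * quad_form X x + c * (d \<bullet> d)"
    and perf:
    "\<And>\<Delta> \<Delta>' x d. \<lbrakk>\<Delta> \<in> D_com; \<Delta>' \<in> D_nonlin; x \<in> carrier_vec n; d \<in> carrier_vec nd\<rbrakk> \<Longrightarrow>
      quad_form X (next_state G \<Delta> \<Delta>' x (K *\<^sub>v x) d) - quad_form X x
        + quad_form Pp (d @\<^sub>v out_e G x (K *\<^sub>v x) d) \<le> - \<gamma> * (d \<bullet> d)"
    using robust_dissipation[OF dims K_dim P' multiplier_class_carrier[OF PP'_class P']
        Pcom_carrier DL Pcom_nonneg F_def[THEN meta_eq_to_obj_eq] LMI[unfolded Ptp_def]]
    unfolding Pp_def D_nonlin_def by blast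
  have stable: "robustly_stable G K n nd D_com D_nonlin"
    unfolding robustly_stable_def
  proof (intro ballI)
    fix \<Delta> \<Delta>' assume \<Delta>: "\<Delta> \<in> D_com" and \<Delta>': "\<Delta>' \<in> D_nonlin"
    show "glob_asymp_stable n (\<lambda>x0. cl_state G K \<Delta> \<Delta>' x0 (\<lambda>_. 0\<^sub>v nd))"
    proof (rule glob_asymp_stable_contraction[OF X(1) \<rho>])
      fix x0 :: "real vec" and k assume x0: "x0 \<in> carrier_vec n"
      show "cl_state G K \<Delta> \<Delta>' x0 (\<lambda>_. 0\<^sub>v nd) k \<in> carrier_vec n"
        by (rule cl_state_carrier[OF dims x0])
      then show "quad_form X (cl_state G K \<Delta> \<Delta>' x0 (\<lambda>_. 0\<^sub>v nd) (Suc k))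
          \<le> \<rho> * quad_form X (cl_state G K \<Delta> \<Delta>' x0 (\<lambda>_. 0\<^sub>v nd) k)"
        using state[OF \<Delta> \<Delta>' _ zero_carrier_vec] by simp
    qed simp
  qed
  have Pp_carrier: "Pp \<in> carrier_mat (nd + ne) (nd + ne)"
    using Pp_sym by (simp add: sym_mat_def)
  obtain CP where CP: "CP > 0" "\<And>v. v \<in> carrier_vec (nd + ne) \<Longrightarrow> \<bar>quad_form Pp v\<bar> \<le> CP * (v \<bullet> v)"
    using quad_form_bound[OF Pp_carrier] by blast
  obtain CE where CE: "CE > 0" "\<And>v. v \<in> carrier_vec n \<Longrightarrow>
      ((pCe G + pDeu G * K) *\<^sub>v v) \<bullet> ((pCe G + pDeu G * K) *\<^sub>v v) \<le> CE * (v \<bullet> v)"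
    using mult_mat_vec_bound[OF E(1)] by blast
  obtain CD where CD: "CD > 0" "\<And>v. v \<in> carrier_vec nd \<Longrightarrow>
      (pDed G *\<^sub>v v) \<bullet> (pDed G *\<^sub>v v) \<le> CD * (v \<bullet> v)"
    using mult_mat_vec_bound[OF E(2)] by blast
  obtain cX where cX: "cX > 0" "\<And>v. v \<in> carrier_vec n \<Longrightarrow> cX * (v \<bullet> v) \<le> quad_form X v"
    using pos_def_lower_bound[OF X(1)] by blast
  \<comment> \<open>This serves the convergence of the performance series: the index term is
    dominated by the storage function and the squared disturbance, which are both summable along
    trajectories.\<close>
  have supply_bound: "\<bar>quad_form Pp (d @\<^sub>v out_e G x (K *\<^sub>v x) d)\<bar>
      \<le> CP * (2 * CE / cX) * quad_form X x + CP * (1 + 2 * CD) * (d \<bullet> d)"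
    if x: "x \<in> carrier_vec n" and d: "d \<in> carrier_vec nd" for x d
  proof -
    let ?e = "out_e G x (K *\<^sub>v x) d"
    have e: "?e \<in> carrier_vec ne"
      by (rule next_state_carrier[OF dims])
    have e_eq: "?e = (pCe G + pDeu G * K) *\<^sub>v x + pDed G *\<^sub>v d"
      unfolding out_e_def closed_loop_mult_vec[OF E(3,4) K_dim x] by simp
    have "?e \<bullet> ?e \<le> 2 * (((pCe G + pDeu G * K) *\<^sub>v x) \<bullet> ((pCe G + pDeu G * K) *\<^sub>v x))
        + 2 * ((pDed G *\<^sub>v d) \<bullet> (pDed G *\<^sub>v d))"
      unfolding e_eq by (rule scalar_prod_add_self_le[of _ ne])
        (use mult_mat_vec_carrier[OF E(1) x] mult_mat_vec_carrier[OF E(2) d] in auto)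
    also have "\<dots> \<le> 2 * (CE * (x \<bullet> x)) + 2 * (CD * (d \<bullet> d))"
      using CE(2)[OF x] CD(2)[OF d] by linarith
    also have "\<dots> \<le> 2 * (CE * (quad_form X x / cX)) + 2 * (CD * (d \<bullet> d))"
      using cX(2)[OF x] cX(1) CE(1) by (simp add: field_simps)
    finally have ee: "?e \<bullet> ?e \<le> 2 * (CE * (quad_form X x / cX)) + 2 * (CD * (d \<bullet> d))" .
    have "\<bar>quad_form Pp (d @\<^sub>v ?e)\<bar> \<le> CP * (d \<bullet> d + ?e \<bullet> ?e)"
      using CP(2)[of "d @\<^sub>v ?e"] d e scalar_prod_append[OF d e d e] by simp
    also have "\<dots> \<le> CP * (d \<bullet> d + (2 * (CE * (quad_form X x / cX)) + 2 * (CD * (d \<bullet> d))))"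
      using ee CP(1) by simp
    finally show ?thesis by (simp add: algebra_simps)
  qed
  have "robust_quadratic_performance G K n nd D_com D_nonlin Pp"
    unfolding robust_quadratic_performance_def Let_def
  proof (intro exI[of _ \<gamma>] conjI \<gamma> allI impI ballI)
    fix d \<Delta> \<Delta>' assume dd: "square_summable nd d" and \<Delta>: "\<Delta> \<in> D_com" and \<Delta>': "\<Delta>' \<in> D_nonlin"
    define x where "x k = cl_state G K \<Delta> \<Delta>' (0\<^sub>v n) d k" for k
    define V where "V k = quad_form X (x k)" for k
    define D where "D k = d k \<bullet> d k" for k
    define s where "s k = quad_form Pp (d k @\<^sub>v out_e G (x k) (K *\<^sub>v x k) (d k))" for k
    have s_eq: "(\<lambda>k. (d k @\<^sub>v cl_out G K \<Delta> \<Delta>' (0\<^sub>v n) d k)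
        \<bullet> (Pp *\<^sub>v (d k @\<^sub>v cl_out G K \<Delta> \<Delta>' (0\<^sub>v n) d k))) = s"
      by (simp add: fun_eq_iff s_def quad_form_def cl_out_def x_def)
    have dk: "d k \<in> carrier_vec nd" for k
      using dd by (simp add: square_summable_def)
    have D: "summable D"
      using dd by (simp add: square_summable_def D_def[abs_def])
    have xk: "x k \<in> carrier_vec n" for k
      unfolding x_def by (rule cl_state_carrier[OF dims zero_carrier_vec])
    have xS: "x (Suc k) = next_state G \<Delta> \<Delta>' (x k) (K *\<^sub>v x k) (d k)" for k
      by (simp add: x_def)
    have V0: "V 0 = 0"
      using mult_mat_vec_carrier[OF XY_carrier(1) zero_carrier_vec]
      by (simp add: V_def x_def quad_form_def)
    have V: "V k \<ge> 0" for k
      unfolding V_def by (rule pos_semidef_quad_form[OF pos_def_imp_pos_semidef[OF X(1)] xk])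
    have VS: "V (Suc k) \<le> \<rho> * V k + c * D k" for k
      using state[OF \<Delta> \<Delta>' xk dk] by (simp add: V_def D_def xS)
    \<comment> \<open>A square-summable disturbance keeps the storage function summable, by the
      contractive state estimate.\<close>
    have sumV: "summable V"
      by (rule summable_linear_recursion[of V D \<rho> c])
        (use V VS D \<rho> c scalar_prod_self_nonneg in \<open>auto simp: D_def\<close>)
    have sums: "summable s"
    proof (rule summable_comparison_test)
      show "\<exists>N. \<forall>k\<ge>N. norm (s k) \<le> CP * (2 * CE / cX) * V k + CP * (1 + 2 * CD) * D k"
        using supply_bound[OF xk dk] by (auto simp: s_def V_def D_def)
      show "summable (\<lambda>k. CP * (2 * CE / cX) * V k + CP * (1 + 2 * CD) * D k)"
        by (intro summable_add summable_mult sumV D)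
    qed
    \<comment> \<open>Summability forces \<open>V\<close> to tend to zero, so no terminal storage is
      left over. As the initial state is zero, the telescoping series vanishes and only the supply
      remains to be compared with the disturbance energy.\<close>
    have tele: "(\<lambda>k. V (Suc k) - V k) sums (0 - V 0)"
      by (rule telescope_sums[OF summable_LIMSEQ_zero[OF sumV]])
    have "(\<lambda>k. (V (Suc k) - V k) + s k) sums (0 - V 0 + suminf s)"
      by (intro sums_add tele summable_sums sums)
    moreover have "(\<lambda>k. - \<gamma> * D k) sums (- \<gamma> * suminf D)"
      by (intro sums_mult summable_sums D)
    moreover have "(V (Suc k) - V k) + s k \<le> - \<gamma> * D k" for k
      unfolding V_def s_def D_def xS by (rule perf[OF \<Delta> \<Delta>' xk dk])
    ultimately have "0 - V 0 + suminf s \<le> - \<gamma> * suminf D"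
      by (rule sums_le[rotated])
    then show "suminf (\<lambda>k. (d k @\<^sub>v cl_out G K \<Delta> \<Delta>' (0\<^sub>v n) d k)
        \<bullet> (Pp *\<^sub>v (d k @\<^sub>v cl_out G K \<Delta> \<Delta>' (0\<^sub>v n) d k))) \<le> - \<gamma> * (\<Sum>k. d k \<bullet> d k)"
      unfolding s_eq V0 by (simp add: D_def[abs_def])
    show "summable (\<lambda>k. (d k @\<^sub>v cl_out G K \<Delta> \<Delta>' (0\<^sub>v n) d k)
        \<bullet> (Pp *\<^sub>v (d k @\<^sub>v cl_out G K \<Delta> \<Delta>' (0\<^sub>v n) d k)))"
      unfolding s_eq by (rule sums)
  qed
  then show ?thesis using stable by blast
qed

end
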